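(* Suppose Assumption A (stated in the context) holds and $K>\sqrt{N}\,K_0$, where $K_0:=\max_{\bm{x}\in\Omega}\|\mathrm{col}(\bm{g}_1(x_1),\dots,\bm{g}_N(x_N))\|$. Consider the differential inclusion $$\dot{\bm{x}}\in\Pi_{\Omega}\big(\bm{x},-\partial_{\bm{x}}\tilde{\mathcal{L}}(\bm{x},\bm{\lambda})\big),\qquad \dot{\bm{\lambda}}\in\Pi_{\mathbb{R}^{MN}_+}\big(\bm{\lambda},-\partial_{\bm{\lambda}}(-\tilde{\mathcal{L}})(\bm{x},\bm{\lambda})\big),\qquad \bm{x}(0)\in\Omega,\ \bm{\lambda}(0)\in\mathbb{R}^{MN}_+.$$ Then this system is stable (every equilibrium point is Lyapunov stable), and any of its solutions converges to the set of saddle points of $\tilde{\mathcal{L}}$ in $\Omega\times\mathbb{R}^{MN}_+$. Moreover, for any solution $(\bm{x}(t),\bm{\lambda}(t))$ there exists a saddle point $(\bm{x}^*,\tilde{\bm{\lambda}}^* )$ of $\tilde{\mathcal{L}}$ in $\Omega\times\mathbb{R}^{MN}_+$ such that $$\lim_{t\to+\infty}(\bm{x}(t),\bm{\lambda}(t))=(\bm{x}^*,\tilde{\bm{\lambda}}^* ).$$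
   Context: Setting. Let $\mathcal{G}=(\mathcal{V},\mathcal{E})$ be a graph with node set $\mathcal{V}=\{1,\dots,N\}$; $\mathcal{N}_i$ is the set of neighbors of node $i$. For each $i\in\mathcal{V}$ let $\Omega_i\subset\mathbb{R}^{n_i}$, let $f_i$ be a real-valued function and $\bm{g}_i=(g_{i1},\dots,g_{iM})^T$ an $\mathbb{R}^M$-valued map, both defined on an open convex set containing $\Omega_i$. Write $\bm{x}=\mathrm{col}(x_1,\dots,x_N)$ for the stacked vector, $\Omega=\prod_{i\in\mathcal{V}}\Omega_i$, $\bm{g}(\bm{x})=\sum_i\bm{g}_i(x_i)$. Vector inequalities are componentwise; $\|\cdot\|$ is the $\ell_2$-norm and $|\cdot|$ the $\ell_1$-norm of vectors; $\mathbb{R}^n_+$ is the set of vectors with nonnegative components. Assumption A. (1) For every $i\in\mathcal{V}$, $\Omega_i$ is compact and convex, and on the open set containing $\Omega_i$, $f_i$ is strictly convex, $\bm{g}_i$ is convex (i.e. each $g_{ik}$ is convex), and $f_i$, $\bm{g}_i$ are locally Lipschitz continuous. (2) There is $\bar{\bm{x}}$ in the relative interior of $\Omega$ with $\bm{g}(\bar{\bm{x}})<\bm{0}$. (3) $\mathcal{G}$ is connected and undirected. For $\bm{\lambda}=\mathrm{col}(\lambda_1,\dots,\lambda_N)$ with $\lambda_i\in\mathbb{R}^M_+$, the modified Lagrangian, with a constant $K>0$, is $$\tilde{\mathcal{L}}(\bm{x},\bm{\lambda})=\sum_{i\in\mathcal{V}}\big(f_i(x_i)+\lambda_i^T\bm{g}_i(x_i)\big)-K\phi(\bm{\lambda}),\qquad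 \phi(\bm{\lambda})=\tfrac12\sum_{i\in\mathcal{V}}\sum_{j\in\mathcal{N}_i}|\lambda_i-\lambda_j|.$$ It is convex in $\bm{x}$ and concave in $\bm{\lambda}$. $\partial_{\bm{x}}\tilde{\mathcal{L}}$ is the convex subdifferential in $\bm{x}$, and $\partial_{\bm{\lambda}}(-\tilde{\mathcal{L}})$ the convex subdifferential of $-\tilde{\mathcal{L}}$ in $\bm{\lambda}$ (the formula for $\tilde{\mathcal L}$ being used for all $\bm{\lambda}\in\mathbb{R}^{MN}$). Explicitly, the $i$-th block of $\partial_{\bm{x}}\tilde{\mathcal{L}}$ is $\partial f_i(x_i)+\partial\bm{g}_i(x_i)\lambda_i$ (meaning $\partial f_i(x_i)+\sum_k\lambda_{ik}\partial g_{ik}(x_i)$). A saddle point of $\tilde{\mathcal{L}}$ in $\Omega\times\mathbb{R}^{MN}_+$ is a point $(\bm{x}^*,\bm{\lambda}^* )$ of this set with $\tilde{\mathcal{L}}(\bm{x}^*,\bm{\lambda})\le\tilde{\mathcal{L}}(\bm{x}^*,\bm{\lambda}^* )\le\tilde{\mathcal{L}}(\bm{x},\bm{\lambda}^* )$ for all $\bm{x}\in\Omega$, $\bm{\lambda}\in\mathbb{R}^{MN}_+$. For a closed convex set $C\subset\mathbb{R}^n$ and $x\in C$, the tangent cone $\mathcal{T}_C(x)$ is the set of limits $\lim_k (x_k-x)/t_k$ with $x_k\in C$, $x_k\to x$, $t_k>0$, $t_k\to0$; $P_C$ is Euclidean projection onto $C$; and $\Pi_C(x,z)=P_{\mathcal{T}_C(x)}(z)$,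 with $\Pi_C(x,Z)=\{\Pi_C(x,z):z\in Z\}$ for a set $Z$. A solution of a differential inclusion is a map on $[0,+\infty)$ that is absolutely continuous (on bounded intervals), has the given initial value, and satisfies the inclusion for almost all $t\in[0,+\infty)$ (here with $\bm{x}(t)\in\Omega$ and $\bm{\lambda}(t)\in\mathbb{R}^{MN}_+$ for all $t$, so that the right-hand side is defined). An equilibrium point is a point at which $\bm{0}$ belongs to the right-hand side; it is Lyapunov stable if for every $\varepsilon>0$ there is $\delta>0$ such that every solution starting (in $\Omega\times\mathbb{R}^{MN}_+$) within distance $\delta$ of it remains within distance $\varepsilon$ for all $t\ge0$. Convergence to a set means the distance to the set tends to $0$ as $t\to+\infty$. *)

theory Defs
  imports "HOL-Analysis.Analysis"
begin

section \<open>Stacked vectors with blocks of different sizes\<close>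

text \<open>
  The stacked vector \<open>x = col(x_1, ..., x_N)\<close> is an element of \<^typ>\<open>real ^ 'd\<close>. The map
  \<open>blk :: 'd \<Rightarrow> 'v\<close> assigns every scalar coordinate to the node it belongs to, so that
  \<open>n_i = card {d. blk d = i}\<close>. The space \<open>\<real>\<^sup>n\<close> with \<open>n = n_i\<close> is represented by the coordinate subspace
  \<open>block_space blk i\<close>, and \<open>x_i\<close> by \<open>block blk i x\<close>, the vector \<open>x\<close> with all
  foreign coordinates replaced by 0.
\<close>

definition block_space :: "('d::finite \<Rightarrow> 'v::finite) \<Rightarrow> 'v \<Rightarrow> (real ^ 'd) set" where
  "block_space blk i = {y. \<forall>d. blk d \<noteq> i \<longrightarrow> y $ d = 0}"

definition block :: "('d::finite \<Rightarrow> 'v::finite) \<Rightarrow> 'v \<Rightarrow> real ^ 'd \<Rightarrow> real ^ 'd" where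
  "block blk i x = (\<chi> d. if blk d = i then x $ d else 0)"

definition block_prod :: "('d::finite \<Rightarrow> 'v::finite) \<Rightarrow> ('v \<Rightarrow> (real ^ 'd) set) \<Rightarrow> (real ^ 'd) set" where
  "block_prod blk S = {x. \<forall>i. block blk i x \<in> S i}"


section \<open>Convex analysis\<close>

definition strictly_convex_on :: "'a::real_vector set \<Rightarrow> ('a \<Rightarrow> real) \<Rightarrow> bool" where
  "strictly_convex_on S F \<longleftrightarrow> convex S \<and>
     (\<forall>x\<in>S. \<forall>y\<in>S. \<forall>u. x \<noteq> y \<longrightarrow> 0 < u \<longrightarrow> u < 1 \<longrightarrow>
        F ((1 - u) *\<^sub>R x + u *\<^sub>R y) < (1 - u) * F x + u * F y)"

definition locally_lipschitz_on :: "'a::metric_space set \<Rightarrow> ('a \<Rightarrow> 'b::metric_space) \<Rightarrow> bool" where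
  "locally_lipschitz_on S F \<longleftrightarrow> (\<forall>x\<in>S. \<exists>r>0. \<exists>L. lipschitz_on L (cball x r \<inter> S) F)"

text \<open>Convex subdifferential at \<open>x\<close> of a function whose domain of definition is \<open>S\<close>.\<close>

definition subdifferential :: "'a::real_inner set \<Rightarrow> ('a \<Rightarrow> real) \<Rightarrow> 'a \<Rightarrow> 'a set" where
  "subdifferential S F x = {v. \<forall>y\<in>S. F y \<ge> F x + v \<bullet> (y - x)}"

definition tangent_cone :: "'a::real_normed_vector set \<Rightarrow> 'a \<Rightarrow> 'a set" where
  "tangent_cone C x = {d. \<exists>(y :: nat \<Rightarrow> 'a) (t :: nat \<Rightarrow> real).
     (\<forall>k. y k \<in> C) \<and> y \<longlonglongrightarrow> x \<and> (\<forall>k. t k > 0) \<and> t \<longlonglongrightarrow> 0 \<and>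
     (\<lambda>k. (1 / t k) *\<^sub>R (y k - x)) \<longlonglongrightarrow> d}"

definition proj_tangent :: "'a::euclidean_space set \<Rightarrow> 'a \<Rightarrow> 'a \<Rightarrow> 'a" where
  "proj_tangent C x z = closest_point (tangent_cone C x) z"


section \<open>The modified Lagrangian\<close>

text \<open>
  Multipliers \<open>\<lambda> = col(\<lambda>_1, ..., \<lambda>_N)\<close> have type \<^typ>\<open>real ^ 'm ^ 'v\<close>, with \<open>\<lambda>_i = l $ i\<close>.
  The norm and inner product of this type are the Euclidean ones of the stacked vector.
\<close>

definition nonneg_orthant :: "(real ^ 'm::finite ^ 'v::finite) set" where
  "nonneg_orthant = {l. \<forall>i k. 0 \<le> l $ i $ k}"

definition l1_norm :: "real ^ 'm::finite \<Rightarrow> real" where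
  "l1_norm y = (\<Sum>k\<in>UNIV. \<bar>y $ k\<bar>)"

definition neighbors :: "('v \<times> 'v) set \<Rightarrow> 'v \<Rightarrow> 'v set" where
  "neighbors E i = {j. (i, j) \<in> E}"

definition disagreement :: "('v::finite \<times> 'v) set \<Rightarrow> real ^ 'm::finite ^ 'v \<Rightarrow> real" where
  "disagreement E l = 1 / 2 * (\<Sum>i\<in>UNIV. \<Sum>j\<in>neighbors E i. l1_norm (l $ i - l $ j))"

definition mod_lagrangian ::
  "('d::finite \<Rightarrow> 'v::finite) \<Rightarrow> ('v \<Rightarrow> real ^ 'd \<Rightarrow> real) \<Rightarrow> ('v \<Rightarrow> real ^ 'd \<Rightarrow> real ^ 'm::finite)
    \<Rightarrow> ('v \<times> 'v) set \<Rightarrow> real \<Rightarrow> real ^ 'd \<Rightarrow> real ^ 'm ^ 'v \<Rightarrow> real" where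
  "mod_lagrangian blk f g E K x l =
     (\<Sum>i\<in>UNIV. f i (block blk i x) + l $ i \<bullet> g i (block blk i x)) - K * disagreement E l"

text \<open>
  The maximum of \<open>\<parallel>col(g_1(x_1), ..., g_N(x_N))\<parallel>\<close> over \<open>\<Omega>\<close>, written as a supremum; it is attained
  when \<open>\<Omega>\<close> is nonempty and compact and the \<open>g_i\<close> are continuous.
\<close>

definition max_constraint_norm ::
  "('d::finite \<Rightarrow> 'v::finite) \<Rightarrow> ('v \<Rightarrow> real ^ 'd \<Rightarrow> real ^ 'm::finite) \<Rightarrow> (real ^ 'd) set \<Rightarrow> real" where
  "max_constraint_norm blk g W = (SUP x\<in>W. norm ((\<chi> i. g i (block blk i x)) :: real ^ 'm ^ 'v))"

definition saddle_points :: "'a set \<Rightarrow> 'b set \<Rightarrow> ('a \<Rightarrow> 'b \<Rightarrow> real) \<Rightarrow> ('a \<times> 'b) set" where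
  "saddle_points X Y L = {(x, l). x \<in> X \<and> l \<in> Y \<and>
     (\<forall>m\<in>Y. L x m \<le> L x l) \<and> (\<forall>y\<in>X. L x l \<le> L y l)}"


section \<open>The projected subgradient dynamics\<close>

text \<open>
  \<open>L\<close> is the Lagrangian, \<open>D\<close> the domain of \<open>\<lambda>y. L y l\<close> (an open convex set containing \<open>X\<close>),
  and \<open>X\<close>, \<open>Y\<close> are the constraint sets of the two variables; the function
  \<open>\<lambda>m. L x m\<close> is defined on the whole space.
\<close>

definition primal_rhs ::
  "'a::euclidean_space set \<Rightarrow> 'a set \<Rightarrow> ('a \<Rightarrow> 'b::euclidean_space \<Rightarrow> real) \<Rightarrow> 'a \<Rightarrow> 'b \<Rightarrow> 'a set" where
  "primal_rhs D X L x l = proj_tangent X x ` (uminus ` subdifferential D (\<lambda>y. L y l) x)"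

definition dual_rhs ::
  "'b::euclidean_space set \<Rightarrow> ('a::euclidean_space \<Rightarrow> 'b \<Rightarrow> real) \<Rightarrow> 'a \<Rightarrow> 'b \<Rightarrow> 'b set" where
  "dual_rhs Y L x l = proj_tangent Y l ` (uminus ` subdifferential UNIV (\<lambda>m. - L x m) l)"

text \<open>Absolute continuity on \<open>[a, b]\<close>: the intervals \<open>(s k, t k)\<close> are pairwise disjoint.\<close>

definition absolutely_continuous_on_interval ::
  "real \<Rightarrow> real \<Rightarrow> (real \<Rightarrow> 'a::real_normed_vector) \<Rightarrow> bool" where
  "absolutely_continuous_on_interval a b u \<longleftrightarrow>
     (\<forall>\<epsilon>>0. \<exists>\<delta>>0. \<forall>(n::nat) (s :: nat \<Rightarrow> real) (t :: nat \<Rightarrow> real).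
        (\<forall>k<n. a \<le> s k \<and> s k \<le> t k \<and> t k \<le> b) \<longrightarrow>
        disjoint_family_on (\<lambda>k. {s k<..<t k}) {..<n} \<longrightarrow>
        (\<Sum>k<n. t k - s k) < \<delta> \<longrightarrow>
        (\<Sum>k<n. norm (u (t k) - u (s k))) < \<epsilon>)"

text \<open>A solution is a map on \<open>[0, \<infinity>)\<close>; its values at negative times are irrelevant.\<close>

definition is_solution ::
  "'a::euclidean_space set \<Rightarrow> 'a set \<Rightarrow> 'b::euclidean_space set \<Rightarrow> ('a \<Rightarrow> 'b \<Rightarrow> real)
    \<Rightarrow> (real \<Rightarrow> 'a) \<Rightarrow> (real \<Rightarrow> 'b) \<Rightarrow> bool" where
  "is_solution D X Y L x l \<longleftrightarrow>
     (\<forall>T\<ge>0. absolutely_continuous_on_interval 0 T x \<and> absolutely_continuous_on_interval 0 T l) \<and>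
     (\<forall>t\<ge>0. x t \<in> X \<and> l t \<in> Y) \<and>
     (AE t in lebesgue. t \<ge> 0 \<longrightarrow>
        (\<exists>x' l'. (x has_vector_derivative x') (at t within {0..}) \<and>
                 (l has_vector_derivative l') (at t within {0..}) \<and>
                 x' \<in> primal_rhs D X L (x t) (l t) \<and> l' \<in> dual_rhs Y L (x t) (l t)))"

definition is_equilibrium ::
  "'a::euclidean_space set \<Rightarrow> 'a set \<Rightarrow> 'b::euclidean_space set \<Rightarrow> ('a \<Rightarrow> 'b \<Rightarrow> real)
    \<Rightarrow> 'a \<times> 'b \<Rightarrow> bool" where
  "is_equilibrium D X Y L p \<longleftrightarrow> fst p \<in> X \<and> snd p \<in> Y \<and>
     0 \<in> primal_rhs D X L (fst p) (snd p) \<and> 0 \<in> dual_rhs Y L (fst p) (snd p)"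

definition lyapunov_stable ::
  "'a::euclidean_space set \<Rightarrow> 'a set \<Rightarrow> 'b::euclidean_space set \<Rightarrow> ('a \<Rightarrow> 'b \<Rightarrow> real)
    \<Rightarrow> 'a \<times> 'b \<Rightarrow> bool" where
  "lyapunov_stable D X Y L p \<longleftrightarrow>
     (\<forall>\<epsilon>>0. \<exists>\<delta>>0. \<forall>x l. is_solution D X Y L x l \<longrightarrow> dist (x 0, l 0) p < \<delta> \<longrightarrow>
        (\<forall>t\<ge>0. dist (x t, l t) p < \<epsilon>))"

end

theory Submission
  imports Defs
begin

text \<open>
  Let \<open>(x\<^sup>*, l\<^sup>*)\<close> be a saddle point. Projecting a velocity \<open>z\<close> onto the tangent cone at \<open>x\<close> never
  decreases its inner product with a direction \<open>y - x\<close> into the convex constraint set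
  (\<open>proj_tangent_variational\<close>). Together with the subgradient inequalities this gives, along every
  solution and for almost every time,
  \<open>d/dt (1/2) |(x, l) - (y, m)|\<^sup>2 \<le> L y l - L x m\<close> for all feasible \<open>(y, m)\<close>; the integrated form is
  \<open>dist_rate\<close>. At a saddle point the right-hand side is the negative of the gap
  \<open>L x l\<^sup>* - L x\<^sup>* l \<ge> 0\<close>, so the distance to every saddle point is nonincreasing. Equilibria are saddle
  points, and stability follows.

  For convergence, boundedness makes the solution Lipschitz, hence the gap uniformly continuous along
  it; since the gap is integrable in time, it tends to 0 (\<open>gap_tendsto_0\<close>). Strict convexity
  turns this into \<open>x t \<longlongrightarrow> x\<^sup>*\<close>. A vanishing gap only says that a cluster point of \<open>l\<close> maximizes
  \<open>L x\<^sup>*\<close>. That it is an optimal multiplier is enforced by the primal dynamics: if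
  \<open>L y lh < L x\<^sup>* lh\<close> at a cluster point \<open>lh\<close>, then \<open>x\<close> would approach \<open>y\<close> at a definite rate during
  time windows of fixed length arbitrarily far out, although \<open>x\<close> converges
  (\<open>cluster_point_is_saddle_point\<close>). So some saddle point is a cluster point of the solution, and
  by monotonicity of the distance to it the whole solution converges to it.

  All this presupposes that a saddle point exists, and this is where the bound on \<open>K\<close> enters. A Slater
  multiplier \<open>\<mu>\<close> of the aggregated problem, copied to every node, is the candidate. Deviating
  from consensus can raise the linear part of the Lagrangian by at most
  \<open>sqrt N * K\<^sub>0 * disagreement\<close>, because on a connected graph every difference \<open>l\<^sub>i - l\<^sub>j\<close> is
  dominated by the disagreement (\<open>weighted_sum_le_consensus\<close>), and the penalty outweighs that.
\<close>

section \<open>Absolutely continuous functions\<close>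

lemma absolutely_continuous_on_intervalD:
  assumes "absolutely_continuous_on_interval a b u" "\<epsilon> > 0"
  shows "\<exists>\<delta>>0. \<forall>(n::nat) s t. (\<forall>k<n. a \<le> s k \<and> s k \<le> t k \<and> t k \<le> b) \<longrightarrow>
        disjoint_family_on (\<lambda>k. {s k<..<t k}) {..<n} \<longrightarrow>
        (\<Sum>k<n. t k - s k) < \<delta> \<longrightarrow> (\<Sum>k<n. norm (u (t k) - u (s k))) < \<epsilon>"
  by (rule assms(1)[unfolded absolutely_continuous_on_interval_def, THEN spec, THEN mp, OF assms(2)])

text \<open>
  A single comparison of increments covers inner products with a fixed vector, squared distances
  and sums.
\<close>

lemma absolutely_continuous_on_interval_dominated:
  fixes u :: "real \<Rightarrow> 'a::real_normed_vector" and v :: "real \<Rightarrow> 'b::real_normed_vector"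
    and w :: "real \<Rightarrow> 'c::real_normed_vector"
  assumes u: "absolutely_continuous_on_interval a b u"
    and v: "absolutely_continuous_on_interval a b v"
    and le: "\<And>s t. a \<le> s \<Longrightarrow> s \<le> t \<Longrightarrow> t \<le> b \<Longrightarrow>
       norm (w t - w s) \<le> C * (norm (u t - u s) + norm (v t - v s))"
  shows "absolutely_continuous_on_interval a b w"
  unfolding absolutely_continuous_on_interval_def
proof (intro allI impI)
  fix \<epsilon> :: real assume "\<epsilon> > 0"
  define \<eta> where "\<eta> = \<epsilon> / (2 * (\<bar>C\<bar> + 1))"
  have "\<eta> > 0" using \<open>\<epsilon> > 0\<close> by (simp add: \<eta>_def)
  obtain d1 where d10: "d1 > 0" and d11: "\<forall>(n::nat) s t. (\<forall>k<n. a \<le> s k \<and> s k \<le> t k \<and> t k \<le> b) \<longrightarrow>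
        disjoint_family_on (\<lambda>k. {s k<..<t k}) {..<n} \<longrightarrow> (\<Sum>k<n. t k - s k) < d1 \<longrightarrow> (\<Sum>k<n. norm (u (t k) - u (s k))) < \<eta>"
    using absolutely_continuous_on_intervalD[OF u \<open>\<eta> > 0\<close>] by blast
  note d1 = d10 d11[THEN spec, THEN spec, THEN spec, THEN mp, THEN mp, THEN mp]
  obtain d2 where d20: "d2 > 0" and d21: "\<forall>(n::nat) s t. (\<forall>k<n. a \<le> s k \<and> s k \<le> t k \<and> t k \<le> b) \<longrightarrow>
        disjoint_family_on (\<lambda>k. {s k<..<t k}) {..<n} \<longrightarrow> (\<Sum>k<n. t k - s k) < d2 \<longrightarrow> (\<Sum>k<n. norm (v (t k) - v (s k))) < \<eta>"
    using absolutely_continuous_on_intervalD[OF v \<open>\<eta> > 0\<close>] by blast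
  note d2 = d20 d21[THEN spec, THEN spec, THEN spec, THEN mp, THEN mp, THEN mp]
  show "\<exists>\<delta>>0. \<forall>(n::nat) s t. (\<forall>k<n. a \<le> s k \<and> s k \<le> t k \<and> t k \<le> b) \<longrightarrow>
        disjoint_family_on (\<lambda>k. {s k<..<t k}) {..<n} \<longrightarrow>
        (\<Sum>k<n. t k - s k) < \<delta> \<longrightarrow> (\<Sum>k<n. norm (w (t k) - w (s k))) < \<epsilon>"
  proof (rule exI[of _ "min d1 d2"], intro conjI allI impI)
    show "0 < min d1 d2" using d1 d2 by simp
  next
    fix n :: nat and s t :: "nat \<Rightarrow> real"
    assume A: "\<forall>k<n. a \<le> s k \<and> s k \<le> t k \<and> t k \<le> b"
       "disjoint_family_on (\<lambda>k. {s k<..<t k}) {..<n}" "(\<Sum>k<n. t k - s k) < min d1 d2"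
    let ?U = "\<Sum>k<n. norm (u (t k) - u (s k))" and ?V = "\<Sum>k<n. norm (v (t k) - v (s k))"
    have U: "?U < \<eta>" and V: "?V < \<eta>" using d1(2)[OF A(1,2)] d2(2)[OF A(1,2)] A(3) by auto
    have "(\<Sum>k<n. norm (w (t k) - w (s k)))
        \<le> (\<Sum>k<n. C * (norm (u (t k) - u (s k)) + norm (v (t k) - v (s k))))"
      by (rule sum_mono) (use A(1) le in auto)
    also have "\<dots> = C * (?U + ?V)" by (simp add: sum_distrib_left sum.distrib algebra_simps)
    also have "\<dots> \<le> \<bar>C\<bar> * (?U + ?V)"
      by (rule mult_right_mono) (auto intro!: add_nonneg_nonneg sum_nonneg)
    also have "\<dots> \<le> \<bar>C\<bar> * (2 * \<eta>)" by (rule mult_left_mono) (use U V in auto)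
    also have "\<dots> < (\<bar>C\<bar> + 1) * (2 * \<eta>)" using \<open>\<eta> > 0\<close> by simp
    also have "\<dots> = \<epsilon>" unfolding \<eta>_def by (simp add: field_simps add_pos_nonneg)
    finally show "(\<Sum>k<n. norm (w (t k) - w (s k))) < \<epsilon>" .
  qed
qed

lemma absolutely_continuous_on_interval_ident:
  "absolutely_continuous_on_interval a b (\<lambda>t::real. t)"
  unfolding absolutely_continuous_on_interval_def
proof (intro allI impI)
  fix \<epsilon> :: real assume "\<epsilon> > 0"
  then show "\<exists>\<delta>>0. \<forall>(n::nat) s t. (\<forall>k<n. a \<le> s k \<and> s k \<le> t k \<and> t k \<le> b) \<longrightarrow>
        disjoint_family_on (\<lambda>k. {s k<..<t k}) {..<n} \<longrightarrow>
        (\<Sum>k<n. t k - s k) < \<delta> \<longrightarrow> (\<Sum>k<n. norm (t k - s k)) < \<epsilon>"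
    by (intro exI[of _ \<epsilon>]) auto
qed

lemma absolutely_continuous_on_interval_imp_continuous_on:
  fixes u :: "real \<Rightarrow> 'a::real_normed_vector"
  assumes u: "absolutely_continuous_on_interval a b u"
  shows "continuous_on {a..b} u"
  unfolding continuous_on_iff
proof (intro ballI allI impI)
  fix t \<epsilon> :: real assume t: "t \<in> {a..b}" and "\<epsilon> > 0"
  obtain d where d0: "d > 0" and d1: "\<forall>(n::nat) s t. (\<forall>k<n. a \<le> s k \<and> s k \<le> t k \<and> t k \<le> b) \<longrightarrow>
        disjoint_family_on (\<lambda>k. {s k<..<t k}) {..<n} \<longrightarrow> (\<Sum>k<n. t k - s k) < d \<longrightarrow> (\<Sum>k<n. norm (u (t k) - u (s k))) < \<epsilon>"
    using absolutely_continuous_on_intervalD[OF u \<open>\<epsilon> > 0\<close>] by blast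
  note d = d0 d1[THEN spec, THEN spec, THEN spec, THEN mp, THEN mp, THEN mp]
  have *: "norm (u q - u p) < \<epsilon>" if "a \<le> p" "p \<le> q" "q \<le> b" "q - p < d" for p q
    using d(2)[of 1 "\<lambda>_. p" "\<lambda>_. q"] that by (simp add: disjoint_family_on_def)
  show "\<exists>d>0. \<forall>s\<in>{a..b}. dist s t < d \<longrightarrow> dist (u s) (u t) < \<epsilon>"
  proof (intro exI[of _ d] conjI ballI impI)
    fix s assume s: "s \<in> {a..b}" "dist s t < d"
    show "dist (u s) (u t) < \<epsilon>"
    proof (cases "s \<le> t")
      case True
      then show ?thesis using *[of s t] s t by (simp add: dist_norm norm_minus_commute)
    next
      case False
      then show ?thesis using *[of t s] s t by (simp add: dist_norm)
    qed
  qed (rule d)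
qed

text \<open>
  The definition speaks of enumerated intervals; tagged divisions provide finite sets of them.
\<close>

lemma absolutely_continuous_on_interval_finite_set:
  fixes u :: "real \<Rightarrow> real"
  assumes ac: "absolutely_continuous_on_interval a b u" and "\<epsilon> > 0"
  shows "\<exists>\<delta>>0. \<forall>(P :: 'i set) s t. finite P \<longrightarrow> (\<forall>k\<in>P. a \<le> s k \<and> s k \<le> t k \<and> t k \<le> b) \<longrightarrow>
       disjoint_family_on (\<lambda>k. {s k<..<t k}) P \<longrightarrow> (\<Sum>k\<in>P. t k - s k) < \<delta> \<longrightarrow>
       (\<Sum>k\<in>P. \<bar>u (t k) - u (s k)\<bar>) < \<epsilon>"
proof -
  obtain d where d0: "d > 0" and d1: "\<forall>(n::nat) s t. (\<forall>k<n. a \<le> s k \<and> s k \<le> t k \<and> t k \<le> b) \<longrightarrow>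
        disjoint_family_on (\<lambda>k. {s k<..<t k}) {..<n} \<longrightarrow> (\<Sum>k<n. t k - s k) < d \<longrightarrow> (\<Sum>k<n. norm (u (t k) - u (s k))) < \<epsilon>"
    using absolutely_continuous_on_intervalD[OF ac \<open>\<epsilon> > 0\<close>] by blast
  note d = d0 d1[THEN spec, THEN spec, THEN spec, THEN mp, THEN mp, THEN mp]
  show ?thesis
  proof (intro exI[of _ d] conjI d(1) allI impI)
    fix P :: "'i set" and s t
    assume A: "finite P" "\<forall>k\<in>P. a \<le> s k \<and> s k \<le> t k \<and> t k \<le> b"
      "disjoint_family_on (\<lambda>k. {s k<..<t k}) P" "(\<Sum>k\<in>P. t k - s k) < d"
    obtain h where h: "bij_betw h {..<card P} P"
      using ex_bij_betw_nat_finite[OF A(1)] by (auto simp: atLeast0LessThan)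
    have "h k \<in> P" if "k < card P" for k using h that by (auto simp: bij_betw_def)
    moreover have "disjoint_family_on (\<lambda>k. {s (h k)<..<t (h k)}) {..<card P}"
      using A(3) h unfolding disjoint_family_on_def bij_betw_def inj_on_def by blast
    moreover have "(\<Sum>k<card P. t (h k) - s (h k)) = (\<Sum>k\<in>P. t k - s k)"
      by (rule sum.reindex_bij_betw[OF h])
    ultimately have "(\<Sum>k<card P. norm (u (t (h k)) - u (s (h k)))) < \<epsilon>"
      using A(2,4) by (intro d(2)) auto
    also have "(\<Sum>k<card P. norm (u (t (h k)) - u (s (h k)))) = (\<Sum>k\<in>P. norm (u (t k) - u (s k)))"
      by (rule sum.reindex_bij_betw[OF h])
    finally show "(\<Sum>k\<in>P. \<bar>u (t k) - u (s k)\<bar>) < \<epsilon>" by simp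
  qed
qed

text \<open>
  The increment of \<open>u\<close> is split over a tagged division. An interval tagged at a point with
  nonpositive derivative contributes at most \<open>\<epsilon>\<close> times its length. The intervals tagged in the null
  set have small total length for a fine enough division, because the integral of the indicator
  function is 0, and absolute continuity bounds what they contribute.
\<close>

lemma absolutely_continuous_nonincreasing:
  fixes u :: "real \<Rightarrow> real"
  assumes ac: "absolutely_continuous_on_interval a b u" and "a \<le> b"
    and N: "negligible N"
    and der: "\<And>t. t \<in> {a..b} \<Longrightarrow> t \<notin> N \<Longrightarrow>
       \<exists>u'. u' \<le> 0 \<and> (u has_vector_derivative u') (at t within {a..b})"
  shows "u b \<le> u a"
proof (rule field_le_epsilon)
  fix e :: real assume "e > 0"
  define \<epsilon> where "\<epsilon> = e / (b - a + 1)"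
  have "\<epsilon> * (b - a + 1) = e" using \<open>a \<le> b\<close> by (simp add: \<epsilon>_def)
  moreover have "\<epsilon> > 0" using \<open>e > 0\<close> \<open>a \<le> b\<close> by (simp add: \<epsilon>_def)
  ultimately have \<epsilon>: "\<epsilon> > 0" "\<epsilon> * (b - a) + \<epsilon> = e" by (simp_all add: distrib_left)
  obtain \<delta> where "\<delta> > 0" and \<delta>_all:
    "\<forall>(P :: (real \<times> real set) set) s t. finite P \<longrightarrow> (\<forall>k\<in>P. a \<le> s k \<and> s k \<le> t k \<and> t k \<le> b) \<longrightarrow>
       disjoint_family_on (\<lambda>k. {s k<..<t k}) P \<longrightarrow> (\<Sum>k\<in>P. t k - s k) < \<delta> \<longrightarrow>
       (\<Sum>k\<in>P. \<bar>u (t k) - u (s k)\<bar>) < \<epsilon>"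
    using absolutely_continuous_on_interval_finite_set[OF ac \<epsilon>(1)] by blast
  note \<delta> = \<open>\<delta> > 0\<close> \<delta>_all[rule_format]
  \<comment> \<open>A gauge for which the intervals tagged in the null set have small total length.\<close>
  have "(indicat_real N has_integral 0) (cbox a b)"
    by (rule has_integral_negligible[OF N]) auto
  then have "\<forall>\<epsilon>>0. \<exists>\<gamma>. gauge \<gamma> \<and> (\<forall>p. p tagged_division_of cbox a b \<and> \<gamma> fine p \<longrightarrow>
      norm ((\<Sum>(x,k)\<in>p. measure lborel k *\<^sub>R indicat_real N x) - 0) < \<epsilon>)"
    unfolding has_integral .
  from this[rule_format, OF \<open>\<delta> > 0\<close>] obtain \<gamma>1 where g1: "gauge \<gamma>1"
    "\<forall>p. p tagged_division_of cbox a b \<and> \<gamma>1 fine p \<longrightarrow>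
      norm ((\<Sum>(x,k)\<in>p. measure lborel k *\<^sub>R indicat_real N x) - 0) < \<delta>"
    by blast
  have "\<exists>d>0. \<forall>s\<in>{a..b}. \<bar>s - t\<bar> < d \<longrightarrow> (s \<ge> t \<longrightarrow> u s - u t \<le> \<epsilon> * (s - t)) \<and>
     (s \<le> t \<longrightarrow> u t - u s \<le> \<epsilon> * (t - s))" if t: "t \<in> {a..b}" "t \<notin> N" for t
  proof -
    obtain u' where u': "u' \<le> 0" "(u has_vector_derivative u') (at t within {a..b})"
      using der[OF t] by blast
    then obtain d where d: "d > 0" "\<And>s. s \<in> {a..b} \<Longrightarrow> \<bar>s - t\<bar> < d \<Longrightarrow>
         \<bar>u s - u t - (s - t) * u'\<bar> \<le> \<epsilon> * \<bar>s - t\<bar>"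
      using \<epsilon>(1) unfolding has_vector_derivative_def has_derivative_within_alt by auto
    have "(s \<ge> t \<longrightarrow> u s - u t \<le> \<epsilon> * (s - t)) \<and> (s \<le> t \<longrightarrow> u t - u s \<le> \<epsilon> * (t - s))"
      if s: "s \<in> {a..b}" "\<bar>s - t\<bar> < d" for s
      using d(2)[OF s] u'(1) mult_nonneg_nonpos[of "s - t" u'] mult_nonneg_nonpos[of "t - s" u']
      by (auto simp: algebra_simps abs_if split: if_splits)
    then show ?thesis using d(1) by blast
  qed
  then have "\<exists>d. \<forall>t\<in>{a..b} - N. d t > 0 \<and> (\<forall>s\<in>{a..b}. \<bar>s - t\<bar> < d t \<longrightarrow>
       (s \<ge> t \<longrightarrow> u s - u t \<le> \<epsilon> * (s - t)) \<and> (s \<le> t \<longrightarrow> u t - u s \<le> \<epsilon> * (t - s)))"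
    by (intro bchoice) blast
  then obtain d where d: "\<And>t. t \<in> {a..b} \<Longrightarrow> t \<notin> N \<Longrightarrow> d t > 0"
    "\<And>t s. t \<in> {a..b} \<Longrightarrow> t \<notin> N \<Longrightarrow> s \<in> {a..b} \<Longrightarrow> \<bar>s - t\<bar> < d t \<Longrightarrow>
       (s \<ge> t \<longrightarrow> u s - u t \<le> \<epsilon> * (s - t)) \<and> (s \<le> t \<longrightarrow> u t - u s \<le> \<epsilon> * (t - s))"
    by blast
  define \<gamma>2 where "\<gamma>2 t = (if t \<in> {a..b} \<and> t \<notin> N then ball t (d t) else ball t 1)" for t
  have g2: "gauge \<gamma>2" unfolding gauge_def \<gamma>2_def using d(1) by auto
  obtain p where "p tagged_division_of {a..b}" "(\<lambda>x. \<gamma>1 x \<inter> \<gamma>2 x) fine p"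
    using fine_division_exists_real[OF gauge_Int[OF g1(1) g2]] by blast
  then have p: "p tagged_division_of {a..b}" "\<gamma>1 fine p" "\<gamma>2 fine p"
    by (auto simp: fine_Int)
  have fin: "finite p" using p(1) by blast
  have K: "\<exists>l r. k = {l..r} \<and> l \<le> r \<and> a \<le> l \<and> r \<le> b \<and> x \<in> {l..r} \<and> Inf k = l \<and> Sup k = r \<and> measure lborel k = r - l"
    if xk: "(x, k) \<in> p" for x k
  proof -
    obtain l r where k: "k = cbox l r" using tagged_division_ofD(4)[OF p(1) xk] by blast
    have "x \<in> k" "k \<subseteq> {a..b}" using tagged_division_ofD(2,3)[OF p(1) xk] by auto
    then show ?thesis using k by (intro exI[of _ l] exI[of _ r]) auto
  qed
  define q where "q = {(x, k) \<in> p. x \<in> N}"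
  have q: "finite q" "q \<subseteq> p" using fin by (auto simp: q_def intro: finite_subset)
  have len: "(\<Sum>(x,k)\<in>q. Sup k - Inf k) < \<delta>"
  proof -
    have "(\<Sum>(x,k)\<in>p. measure lborel k *\<^sub>R indicat_real N x) = (\<Sum>(x,k)\<in>p. if x \<in> N then Sup k - Inf k else 0)"
      using K by (intro sum.cong) (fastforce simp: indicator_def)+
    also have "\<dots> = (\<Sum>(x,k)\<in>q. Sup k - Inf k)"
      using sum.inter_filter[OF fin, of "\<lambda>z. Sup (snd z) - Inf (snd z)" "\<lambda>z. fst z \<in> N"]
      by (simp add: q_def case_prod_unfold)
    finally show ?thesis using g1(2) p by auto
  qed
  have small: "(\<Sum>z\<in>q. \<bar>u (Sup (snd z)) - u (Inf (snd z))\<bar>) < \<epsilon>"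
  proof (rule \<delta>(2)[OF q(1)])
    fix z assume "z \<in> q" then show "a \<le> Inf (snd z) \<and> Inf (snd z) \<le> Sup (snd z) \<and> Sup (snd z) \<le> b"
      using K q(2) by (cases z) force
  next
    have "{Inf (snd y)<..<Sup (snd y)} \<inter> {Inf (snd z)<..<Sup (snd z)} = {}"
      if "y \<in> q" "z \<in> q" "y \<noteq> z" for y z
    proof -
      have yz: "(fst y, snd y) \<in> p" "(fst z, snd z) \<in> p" "(fst y, snd y) \<noteq> (fst z, snd z)"
        using that q(2) by auto
      have "interior (snd y) \<inter> interior (snd z) = {}"
        using tagged_division_ofD(5)[OF p(1) yz] .
      moreover obtain l r where "snd y = {l..r}" "Inf (snd y) = l" "Sup (snd y) = r"
        using K[OF yz(1)] by blast
      moreover obtain l' r' where "snd z = {l'..r'}" "Inf (snd z) = l'" "Sup (snd z) = r'"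
        using K[OF yz(2)] by blast
      ultimately show ?thesis by (simp add: interior_atLeastAtMost_real)
    qed
    then show "disjoint_family_on (\<lambda>k. {Inf (snd k)<..<Sup (snd k)}) q"
      unfolding disjoint_family_on_def by blast
  next
    show "(\<Sum>k\<in>q. Sup (snd k) - Inf (snd k)) < \<delta>" using len by (simp add: case_prod_unfold)
  qed
  have "u b - u a = (\<Sum>(x,k)\<in>p. u (Sup k) - u (Inf k))"
    using additive_tagged_division_1[OF \<open>a \<le> b\<close> p(1), of u] by simp
  also have "\<dots> \<le> (\<Sum>z\<in>p. \<epsilon> * (Sup (snd z) - Inf (snd z)) +
       (if z \<in> q then \<bar>u (Sup (snd z)) - u (Inf (snd z))\<bar> else 0))"
  proof (rule sum_mono)
    fix z assume z: "z \<in> p"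
    obtain x k where zx: "z = (x, k)" by force
    obtain l r where lr: "k = {l..r}" "l \<le> r" "a \<le> l" "r \<le> b" "x \<in> {l..r}" "Inf k = l" "Sup k = r"
      using K z zx by blast
    show "(case z of (x, k) \<Rightarrow> u (Sup k) - u (Inf k)) \<le> \<epsilon> * (Sup (snd z) - Inf (snd z)) +
       (if z \<in> q then \<bar>u (Sup (snd z)) - u (Inf (snd z))\<bar> else 0)"
    proof (cases "x \<in> N")
      case True
      then have "z \<in> q" using z zx by (simp add: q_def)
      moreover have "0 \<le> \<epsilon> * (r - l)" using \<epsilon>(1) lr by simp
      ultimately show ?thesis using zx lr by (simp add: abs_if)
    next
      case False
      then have "z \<notin> q" using zx by (simp add: q_def)
      have x: "x \<in> {a..b}" using lr by auto
      have "k \<subseteq> ball x (d x)" using p(3) z zx False x unfolding fine_def \<gamma>2_def by force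
      then have "\<bar>l - x\<bar> < d x" "\<bar>r - x\<bar> < d x" using lr by (force simp: dist_real_def subset_iff)+
      then have "u r - u x \<le> \<epsilon> * (r - x)" "u x - u l \<le> \<epsilon> * (x - l)"
        using d(2)[OF x False, of r] d(2)[OF x False, of l] lr by auto
      then show ?thesis using zx lr \<open>z \<notin> q\<close> by (simp add: algebra_simps)
    qed
  qed
  also have "\<dots> = \<epsilon> * (\<Sum>(x,k)\<in>p. Sup k - Inf k) + (\<Sum>z\<in>q. \<bar>u (Sup (snd z)) - u (Inf (snd z))\<bar>)"
    using fin q(2) by (simp add: sum.distrib sum_distrib_left case_prod_unfold sum.If_cases Int_absorb1)
  also have "(\<Sum>(x,k)\<in>p. Sup k - Inf k) = b - a"
    using additive_tagged_division_1[OF \<open>a \<le> b\<close> p(1), of "\<lambda>t. t"] by simp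
  finally show "u b \<le> u a + e" using small \<epsilon>(2) by linarith
qed

lemma absolutely_continuous_derivative_le:
  fixes u :: "real \<Rightarrow> real"
  assumes ac: "absolutely_continuous_on_interval a b u" and "a \<le> b"
    and N: "negligible N"
    and der: "\<And>t. t \<in> {a..b} \<Longrightarrow> t \<notin> N \<Longrightarrow>
       \<exists>u'. u' \<le> c \<and> (u has_vector_derivative u') (at t within {a..b})"
  shows "u b - u a \<le> c * (b - a)"
proof -
  have "absolutely_continuous_on_interval a b (\<lambda>t. u t - c * t)"
  proof (rule absolutely_continuous_on_interval_dominated[OF ac
        absolutely_continuous_on_interval_ident, where C = "1 + \<bar>c\<bar>"])
    fix s t :: real
    have "norm (u t - c * t - (u s - c * s)) \<le> \<bar>u t - u s\<bar> + \<bar>c * (t - s)\<bar>"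
      by (simp add: algebra_simps abs_if)
    also have "\<dots> \<le> (1 + \<bar>c\<bar>) * (norm (u t - u s) + norm (t - s))"
      by (simp add: abs_mult distrib_left distrib_right)
    finally show "norm (u t - c * t - (u s - c * s)) \<le> (1 + \<bar>c\<bar>) * (norm (u t - u s) + norm (t - s))" .
  qed
  then have "u b - c * b \<le> u a - c * a"
  proof (rule absolutely_continuous_nonincreasing[OF _ \<open>a \<le> b\<close> N])
    fix t assume "t \<in> {a..b}" "t \<notin> N"
    from der[OF this] obtain u' where u': "u' \<le> c" "(u has_vector_derivative u') (at t within {a..b})"
      by blast
    have "((\<lambda>t. u t - c * t) has_vector_derivative u' - c) (at t within {a..b})"
      using u'(2) by (auto intro!: derivative_eq_intros simp: has_real_derivative_iff_has_vector_derivative[symmetric])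
    then show "\<exists>u'\<le>0. ((\<lambda>t. u t - c * t) has_vector_derivative u') (at t within {a..b})"
      using u'(1) by (intro exI[of _ "u' - c"]) auto
  qed
  then show ?thesis by (simp add: algebra_simps)
qed

text \<open>
  Reduces to the scalar case by projecting onto the direction of the increment.
\<close>

lemma absolutely_continuous_derivative_norm_le:
  fixes u :: "real \<Rightarrow> 'a::real_inner"
  assumes ac: "absolutely_continuous_on_interval a b u" and "a \<le> b"
    and N: "negligible N"
    and der: "\<And>t. t \<in> {a..b} \<Longrightarrow> t \<notin> N \<Longrightarrow>
       \<exists>u'. norm u' \<le> C \<and> (u has_vector_derivative u') (at t within {a..b})"
  shows "norm (u b - u a) \<le> C * (b - a)"
proof (cases "u b = u a")
  case True
  show ?thesis
  proof (cases "C \<ge> 0")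
    case False
    then have "{a..b} \<subseteq> N" using der norm_ge_zero by (metis order_trans subsetI)
    then have "negligible {a..b}" using N negligible_subset by blast
    then have "a = b" using \<open>a \<le> b\<close> negligible_interval(1)[of a b] by (auto simp: box_real)
    then show ?thesis using True by simp
  qed (use True \<open>a \<le> b\<close> in simp)
next
  case False
  define e where "e = (1 / norm (u b - u a)) *\<^sub>R (u b - u a)"
  have e: "norm e = 1" "(u b - u a) \<bullet> e = norm (u b - u a)"
    using False by (auto simp: e_def power2_norm_eq_inner[symmetric] power2_eq_square)
  have "u b \<bullet> e - u a \<bullet> e \<le> C * (b - a)"
  proof (rule absolutely_continuous_derivative_le[OF _ \<open>a \<le> b\<close> N])
    show "absolutely_continuous_on_interval a b (\<lambda>t. u t \<bullet> e)"
    proof (rule absolutely_continuous_on_interval_dominated[OF ac ac, where C = 1])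
      fix s t
      have "norm (u t \<bullet> e - u s \<bullet> e) \<le> norm (u t - u s) * norm e"
        unfolding inner_diff_left[symmetric] real_norm_def by (rule Cauchy_Schwarz_ineq2)
      then show "norm (u t \<bullet> e - u s \<bullet> e) \<le> 1 * (norm (u t - u s) + norm (u t - u s))"
        using e by (simp add: add_increasing2)
    qed
  next
    fix t assume "t \<in> {a..b}" "t \<notin> N"
    from der[OF this] obtain u' where u': "norm u' \<le> C" "(u has_vector_derivative u') (at t within {a..b})"
      by blast
    have "u' \<bullet> e \<le> C" using norm_cauchy_schwarz[of u' e] u'(1) e(1) by simp
    moreover have "((\<lambda>t. u t \<bullet> e) has_vector_derivative u' \<bullet> e) (at t within {a..b})"
      by (rule bounded_linear.has_vector_derivative[OF bounded_linear_inner_left u'(2)])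
    ultimately show "\<exists>u'\<le>C. ((\<lambda>t. u t \<bullet> e) has_vector_derivative u') (at t within {a..b})" by blast
  qed
  then show ?thesis using e(2) by (simp add: inner_diff_left)
qed

lemma absolutely_continuous_on_interval_subset:
  assumes "absolutely_continuous_on_interval a b u" "a \<le> c" "d \<le> b"
  shows "absolutely_continuous_on_interval c d u"
  unfolding absolutely_continuous_on_interval_def
proof (intro allI impI)
  fix \<epsilon> :: real assume "\<epsilon> > 0"
  from absolutely_continuous_on_intervalD[OF assms(1) this] obtain \<delta> where "\<delta> > 0" and \<delta>:
      "\<forall>(n::nat) s t. (\<forall>k<n. a \<le> s k \<and> s k \<le> t k \<and> t k \<le> b) \<longrightarrow>
        disjoint_family_on (\<lambda>k. {s k<..<t k}) {..<n} \<longrightarrow>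
        (\<Sum>k<n. t k - s k) < \<delta> \<longrightarrow> (\<Sum>k<n. norm (u (t k) - u (s k))) < \<epsilon>" by blast
  show "\<exists>\<delta>>0. \<forall>(n::nat) s t. (\<forall>k<n. c \<le> s k \<and> s k \<le> t k \<and> t k \<le> d) \<longrightarrow>
        disjoint_family_on (\<lambda>k. {s k<..<t k}) {..<n} \<longrightarrow>
        (\<Sum>k<n. t k - s k) < \<delta> \<longrightarrow> (\<Sum>k<n. norm (u (t k) - u (s k))) < \<epsilon>"
  proof (intro exI[of _ \<delta>] conjI \<open>\<delta> > 0\<close> allI impI)
    fix n :: nat and s t :: "nat \<Rightarrow> real"
    assume A: "\<forall>k<n. c \<le> s k \<and> s k \<le> t k \<and> t k \<le> d"
      and B: "disjoint_family_on (\<lambda>k. {s k<..<t k}) {..<n}" "(\<Sum>k<n. t k - s k) < \<delta>"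
    have "\<forall>k<n. a \<le> s k \<and> s k \<le> t k \<and> t k \<le> b" using A assms(2,3) by force
    then show "(\<Sum>k<n. norm (u (t k) - u (s k))) < \<epsilon>" using \<delta> B by blast
  qed
qed

lemma absolutely_continuous_half_norm_sq:
  fixes u :: "real \<Rightarrow> 'a::real_inner"
  assumes ac: "absolutely_continuous_on_interval a b u"
  shows "absolutely_continuous_on_interval a b (\<lambda>t. (norm (u t - p))\<^sup>2 / 2)"
proof -
  have "bounded (u ` {a..b})"
    by (intro compact_imp_bounded compact_continuous_image compact_Icc
        absolutely_continuous_on_interval_imp_continuous_on ac)
  then obtain M where M: "\<And>t. t \<in> {a..b} \<Longrightarrow> norm (u t) \<le> M"
    unfolding bounded_iff by blast
  define B where "B = M + norm p"
  have B: "norm (u t - p) \<le> B" if "t \<in> {a..b}" for t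
    using norm_triangle_ineq4[of "u t" p] M[OF that] by (simp add: B_def)
  show ?thesis
  proof (rule absolutely_continuous_on_interval_dominated[OF ac ac, where C = "B / 2"])
    fix s t assume st: "a \<le> s" "s \<le> t" "t \<le> b"
    let ?P = "norm (u t - p)" and ?Q = "norm (u s - p)"
    have "\<bar>?P - ?Q\<bar> \<le> norm (u t - u s)" using norm_triangle_ineq3[of "u t - p" "u s - p"] by simp
    moreover have "?P + ?Q \<le> 2 * B" using B[of s] B[of t] st by simp
    ultimately have "\<bar>?P - ?Q\<bar> * (?P + ?Q) \<le> norm (u t - u s) * (2 * B)" by (intro mult_mono) auto
    moreover have "\<bar>?P\<^sup>2 - ?Q\<^sup>2\<bar> = \<bar>?P - ?Q\<bar> * (?P + ?Q)"
      by (simp add: square_diff_square_factored power2_eq_square abs_mult mult.commute)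
    moreover have "norm (?P\<^sup>2 / 2 - ?Q\<^sup>2 / 2) = \<bar>?P\<^sup>2 - ?Q\<^sup>2\<bar> / 2"
      by (simp add: diff_divide_distrib[symmetric])
    ultimately show "norm (?P\<^sup>2 / 2 - ?Q\<^sup>2 / 2) \<le> B / 2 * (norm (u t - u s) + norm (u t - u s))"
      by (simp add: algebra_simps)
  qed
qed

lemma half_norm_sq_has_vector_derivative:
  assumes "(u has_vector_derivative u') (at t within S)"
  shows "((\<lambda>t. (norm (u t - p))\<^sup>2 / 2) has_vector_derivative (u t - p) \<bullet> u') (at t within S)"
proof -
  have u: "((\<lambda>t. u t - p) has_vector_derivative u') (at t within S)"
    using has_vector_derivative_diff[OF assms has_vector_derivative_const[of p]] by simp
  have "((\<lambda>t. (u t - p) \<bullet> (u t - p)) has_vector_derivative 2 * ((u t - p) \<bullet> u')) (at t within S)"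
    using bounded_bilinear.has_vector_derivative[OF bounded_bilinear_inner u u]
    by (simp add: inner_commute)
  from bounded_linear.has_vector_derivative[OF bounded_linear_divide[of 2] this]
  show ?thesis by (simp add: power2_norm_eq_inner)
qed

lemma absolutely_continuous_half_norm_sq_le:
  fixes u :: "real \<Rightarrow> 'a::real_inner" and v :: "real \<Rightarrow> 'b::real_inner"
  assumes ac: "absolutely_continuous_on_interval a b u" "absolutely_continuous_on_interval a b v"
    and "a \<le> b" and N: "negligible N"
    and der: "\<And>t. t \<in> {a..b} \<Longrightarrow> t \<notin> N \<Longrightarrow> \<exists>u' v'.
       (u has_vector_derivative u') (at t within {a..b}) \<and>
       (v has_vector_derivative v') (at t within {a..b}) \<and> (u t - p) \<bullet> u' + (v t - q) \<bullet> v' \<le> c"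
  shows "((norm (u b - p))\<^sup>2 / 2 + (norm (v b - q))\<^sup>2 / 2) - ((norm (u a - p))\<^sup>2 / 2 + (norm (v a - q))\<^sup>2 / 2) \<le> c * (b - a)"
proof (rule absolutely_continuous_derivative_le[OF _ \<open>a \<le> b\<close> N])
  show "absolutely_continuous_on_interval a b (\<lambda>t. (norm (u t - p))\<^sup>2 / 2 + (norm (v t - q))\<^sup>2 / 2)"
    using absolutely_continuous_half_norm_sq[OF ac(1)] absolutely_continuous_half_norm_sq[OF ac(2)]
  proof (rule absolutely_continuous_on_interval_dominated[where C = 1])
    fix s t
    show "norm ((norm (u t - p))\<^sup>2 / 2 + (norm (v t - q))\<^sup>2 / 2 - ((norm (u s - p))\<^sup>2 / 2 + (norm (v s - q))\<^sup>2 / 2))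
      \<le> 1 * (norm ((norm (u t - p))\<^sup>2 / 2 - (norm (u s - p))\<^sup>2 / 2) + norm ((norm (v t - q))\<^sup>2 / 2 - (norm (v s - q))\<^sup>2 / 2))"
      unfolding real_norm_def mult_1 by arith
  qed
next
  fix t assume "t \<in> {a..b}" "t \<notin> N"
  from der[OF this] obtain u' v' where "(u has_vector_derivative u') (at t within {a..b})"
      "(v has_vector_derivative v') (at t within {a..b})" and le: "(u t - p) \<bullet> u' + (v t - q) \<bullet> v' \<le> c"
    by blast
  from has_vector_derivative_add[OF this(1,2)[THEN half_norm_sq_has_vector_derivative]] le
  show "\<exists>u'\<le>c. ((\<lambda>t. (norm (u t - p))\<^sup>2 / 2 + (norm (v t - q))\<^sup>2 / 2) has_vector_derivative u')
     (at t within {a..b})"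
    by blast
qed

section \<open>Tangent cones and subgradients of convex functions\<close>

text \<open>
  The description by sequences hides that the tangent cone is closed and convex; both are obvious
  for the closure of the cone of feasible directions.
\<close>

lemma tangent_cone_eq_closure:
  assumes "convex C" "x \<in> C"
  shows "tangent_cone C x = closure {c *\<^sub>R (y - x) | c y. 0 \<le> c \<and> y \<in> C}" (is "_ = closure ?F")
proof (intro set_eqI iffI)
  fix d assume "d \<in> tangent_cone C x"
  then obtain y :: "nat \<Rightarrow> 'a" and t :: "nat \<Rightarrow> real" where y: "\<And>k. y k \<in> C" "\<And>k. t k > 0"
    "(\<lambda>k. (1 / t k) *\<^sub>R (y k - x)) \<longlonglongrightarrow> d" unfolding tangent_cone_def by blast
  moreover have "(1 / t k) *\<^sub>R (y k - x) \<in> ?F" for k using y(1,2)[of k] by force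
  ultimately show "d \<in> closure ?F"
    unfolding closure_sequential by (intro exI[of _ "\<lambda>k. (1 / t k) *\<^sub>R (y k - x)"]) simp
next
  fix d assume "d \<in> closure ?F"
  then obtain w where w: "\<And>k. w k \<in> ?F" "w \<longlonglongrightarrow> d" unfolding closure_sequential by blast
  have "\<exists>c y. 0 \<le> c \<and> y \<in> C \<and> w k = c *\<^sub>R (y - x)" for k using w(1)[of k] by blast
  then obtain c y where cy: "\<And>k. 0 \<le> c k" "\<And>k. y k \<in> C" "\<And>k. w k = c k *\<^sub>R (y k - x)"
    by metis
  \<comment> \<open>Rescaling the steps keeps the points \<open>x + t k * w k\<close> in the convex set.\<close>
  define t where "t k = inverse (real (Suc k)) / (1 + c k)" for k
  have t: "t k > 0" "t k * c k \<le> 1" "0 \<le> t k * c k" "t k \<le> inverse (real (Suc k))" for k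
  proof -
    show "t k > 0" using cy(1)[of k] by (simp add: t_def add_pos_nonneg)
    have "inverse (real (Suc k)) \<le> 1" by (simp add: field_simps)
    then have "inverse (real (Suc k)) * c k \<le> 1 * c k" using cy(1)[of k] by (rule mult_right_mono)
    also have "\<dots> \<le> 1 * (1 + c k)" by simp
    finally show "t k * c k \<le> 1" using cy(1)[of k] by (simp add: t_def divide_le_eq add_pos_nonneg)
    show "0 \<le> t k * c k" using cy(1)[of k] \<open>t k > 0\<close> by simp
    show "t k \<le> inverse (real (Suc k))" using cy(1)[of k] unfolding t_def
      by (simp add: divide_le_eq mult_le_cancel_left1 add_pos_nonneg)
  qed
  have t0: "t \<longlonglongrightarrow> 0"
    by (rule tendsto_sandwich[OF always_eventually always_eventually tendsto_const
          LIMSEQ_inverse_real_of_nat])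
       (auto simp del: of_nat_Suc intro: t(4) less_imp_le[OF t(1)])
  have in_C: "x + t k *\<^sub>R w k \<in> C" for k
  proof -
    have "x + t k *\<^sub>R w k = (1 - t k * c k) *\<^sub>R x + (t k * c k) *\<^sub>R y k"
      by (simp add: cy(3) algebra_simps)
    then show ?thesis using convexD_alt[OF assms(1,2) cy(2)[of k] t(3,2)[of k]] by simp
  qed
  have "(\<lambda>k. x + t k *\<^sub>R w k) \<longlonglongrightarrow> x + 0 *\<^sub>R d" by (intro tendsto_intros t0 w)
  moreover have "(\<lambda>k. (1 / t k) *\<^sub>R ((x + t k *\<^sub>R w k) - x)) = w"
  proof
    fix k show "(1 / t k) *\<^sub>R ((x + t k *\<^sub>R w k) - x) = w k" using t(1)[of k] by simp
  qed
  ultimately show "d \<in> tangent_cone C x" unfolding tangent_cone_def using in_C t(1) t0 w(2)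
    by (intro CollectI exI[of _ "\<lambda>k. x + t k *\<^sub>R w k"] exI[of _ t]) simp
qed

lemma convex_feasible_directions:
  assumes "convex C" "x \<in> C"
  shows "convex {c *\<^sub>R (y - x) | c y. 0 \<le> c \<and> y \<in> C}"
proof -
  have "convex ((\<lambda>y. y - x) ` C)" using convex_translation_subtract[OF assms(1)] .
  then have "convex (conic hull ((\<lambda>y. y - x) ` C))" by (rule convex_conic_hull)
  moreover have "conic hull ((\<lambda>y. y - x) ` C) = {c *\<^sub>R (y - x) | c y. 0 \<le> c \<and> y \<in> C}"
    unfolding conic_hull_explicit by blast
  ultimately show ?thesis by simp
qed

lemma
  assumes "convex C" "x \<in> C"
  shows convex_tangent_cone: "convex (tangent_cone C x)"
    and closed_tangent_cone: "closed (tangent_cone C x)"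
    and feasible_direction_in_tangent_cone: "y \<in> C \<Longrightarrow> y - x \<in> tangent_cone C x"
    and tangent_cone_scale: "d \<in> tangent_cone C x \<Longrightarrow> 0 \<le> a \<Longrightarrow> a *\<^sub>R d \<in> tangent_cone C x"
proof -
  let ?F = "{c *\<^sub>R (y - x) | c y. 0 \<le> c \<and> y \<in> C}"
  note eq = tangent_cone_eq_closure[OF assms]
  show "convex (tangent_cone C x)" unfolding eq
    by (rule convex_closure[OF convex_feasible_directions[OF assms]])
  show "closed (tangent_cone C x)" unfolding eq by simp
  show "y - x \<in> tangent_cone C x" if "y \<in> C"
  proof -
    have "1 *\<^sub>R (y - x) \<in> ?F" using that zero_le_one by blast
    then show ?thesis unfolding eq using closure_subset[of ?F] by auto
  qed
  show "a *\<^sub>R d \<in> tangent_cone C x" if "d \<in> tangent_cone C x" "0 \<le> a"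
  proof -
    have "((*\<^sub>R) a) ` ?F \<subseteq> ?F" using \<open>0 \<le> a\<close> by (force simp: image_iff)
    then have "((*\<^sub>R) a) ` closure ?F \<subseteq> closure ?F"
      unfolding closure_scaleR by (rule closure_mono)
    then show ?thesis using that(1) unfolding eq by blast
  qed
qed

text \<open>
  The tangent cone is closed under addition, so the variational inequality of the projection
  \<open>d\<close> of \<open>z\<close> can be tested with the point \<open>d + w\<close>: the residual \<open>z - d\<close> is in the polar cone.
\<close>

lemma proj_tangent_inner_le:
  assumes "convex C" "x \<in> C" "w \<in> tangent_cone C x"
  shows "(z - proj_tangent C x z) \<bullet> w \<le> 0"
proof -
  let ?T = "tangent_cone C x" and ?d = "proj_tangent C x z"
  note T = convex_tangent_cone[OF assms(1,2)] closed_tangent_cone[OF assms(1,2)]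
  have d: "?d \<in> ?T" unfolding proj_tangent_def using T(2) assms(3) by (intro closest_point_in_set) auto
  have "(1/2) *\<^sub>R ?d + (1/2) *\<^sub>R w \<in> ?T" using convexD[OF T(1) d assms(3)] by simp
  then have "2 *\<^sub>R ((1/2) *\<^sub>R ?d + (1/2) *\<^sub>R w) \<in> ?T" by (intro tangent_cone_scale assms) auto
  then have "?d + w \<in> ?T" by (simp add: scaleR_add_right)
  from closest_point_dot[OF T this, of z] show ?thesis by (simp add: proj_tangent_def)
qed

lemma proj_tangent_variational:
  assumes "convex C" "x \<in> C" "y \<in> C"
  shows "z \<bullet> (y - x) \<le> proj_tangent C x z \<bullet> (y - x)"
  using proj_tangent_inner_le[OF assms(1,2) feasible_direction_in_tangent_cone[OF assms], of z]
  by (simp add: inner_diff_left)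

lemma norm_proj_tangent_le:
  assumes "convex C" "x \<in> C"
  shows "norm (proj_tangent C x z) \<le> norm z"
proof -
  let ?T = "tangent_cone C x" and ?d = "proj_tangent C x z"
  note T = convex_tangent_cone[OF assms] closed_tangent_cone[OF assms]
  have "0 \<in> ?T" using feasible_direction_in_tangent_cone[OF assms assms(2)] by simp
  from closest_point_dot[OF T this, of z] have "?d \<bullet> ?d \<le> z \<bullet> ?d"
    by (simp add: proj_tangent_def inner_diff_left)
  also have "\<dots> \<le> norm z * norm ?d" by (rule norm_cauchy_schwarz)
  finally have "norm ?d * norm ?d \<le> norm z * norm ?d" by (simp add: power2_norm_eq_inner[symmetric] power2_eq_square)
  then show ?thesis by (cases "norm ?d = 0") (auto simp: mult_le_cancel_right)
qed

text \<open>
  A subgradient \<open>v\<close> at \<open>x\<close> forces the function to grow by \<open>r * norm v\<close> over a step of length \<open>r\<close> in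
  the direction of \<open>v\<close>. A uniform \<open>r\<close> keeps these steps inside a compact part of the domain, where the
  function is bounded, uniformly in the parameter \<open>p\<close>.
\<close>

lemma subdifferential_bounded_on_compact:
  fixes F :: "'b::euclidean_space \<Rightarrow> 'a::euclidean_space \<Rightarrow> real"
  assumes S: "compact S" "S \<subseteq> D" "open D" and P: "compact P"
    and F: "continuous_on (D \<times> P) (\<lambda>(x, p). F p x)"
  obtains B where "\<And>x p v. x \<in> S \<Longrightarrow> p \<in> P \<Longrightarrow> v \<in> subdifferential D (F p) x \<Longrightarrow> norm v \<le> B"
proof -
  obtain r where r: "r > 0" "(\<Union>x\<in>S. cball x r) \<subseteq> D"
    using compact_subset_open_imp_cball_epsilon_subset[OF S(1,3,2)] .
  define S' where "S' = {x + y | x y. x \<in> S \<and> y \<in> cball 0 r}"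
  have "compact S'" unfolding S'_def using compact_sums[OF S(1) compact_cball] .
  have "S' \<subseteq> D" using r(2) by (force simp: S'_def subset_iff dist_norm)
  have "bounded ((\<lambda>(x, p). F p x) ` (S' \<times> P))"
    using \<open>S' \<subseteq> D\<close> by (intro compact_imp_bounded compact_continuous_image continuous_on_subset[OF F] compact_Times \<open>compact S'\<close> P) auto
  then obtain B where B: "\<And>x p. x \<in> S' \<Longrightarrow> p \<in> P \<Longrightarrow> \<bar>F p x\<bar> \<le> B"
    by (auto simp: bounded_iff)
  show ?thesis
  proof (rule that)
    fix x p v assume x: "x \<in> S" and p: "p \<in> P" and v: "v \<in> subdifferential D (F p) x"
    show "norm v \<le> 2 * B / r"
    proof (cases "v = 0")
      case True
      have "x + 0 \<in> S'" using x r(1) unfolding S'_def by force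
      then have "x \<in> S'" by simp
      then have "0 \<le> B" using B[OF _ p] abs_ge_zero order_trans by blast
      then show ?thesis using True r by simp
    next
      case False
      define y where "y = (r / norm v) *\<^sub>R v"
      have y: "norm y = r" "v \<bullet> y = r * norm v"
        using r(1) False by (auto simp: y_def power2_norm_eq_inner[symmetric] power2_eq_square)
      have "x + w \<in> S'" if "norm w \<le> r" for w using x that unfolding S'_def by auto
      from this[of y] this[of 0] have S': "x + y \<in> S'" "x \<in> S'" using y(1) r(1) by auto
      then have "F p (x + y) \<ge> F p x + v \<bullet> (x + y - x)"
        using v \<open>S' \<subseteq> D\<close> unfolding subdifferential_def by blast
      then have "r * norm v \<le> F p (x + y) - F p x" using y by simp
      also have "\<dots> \<le> 2 * B" using B[OF S'(1) p] B[OF S'(2) p] by simp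
      finally show ?thesis using r(1) by (simp add: field_simps)
    qed
  qed
qed

section \<open>Projected subgradient dynamics of a saddle function\<close>

text \<open>
  The subgradients in the dynamics themselves supply the convexity inequalities for \<open>L\<close>; the
  contribution of strict convexity is the uniqueness of the primal minimizer at a saddle point.
\<close>

locale saddle_flow =
  fixes D X :: "'a::euclidean_space set" and Y :: "'b::euclidean_space set"
    and L :: "'a \<Rightarrow> 'b \<Rightarrow> real"
  assumes compact_X: "compact X" and convex_X: "convex X"
    and open_D: "open D" and X_subset_D: "X \<subseteq> D"
    and closed_Y: "closed Y" and convex_Y: "convex Y"
    and continuous_L: "continuous_on (D \<times> UNIV) (\<lambda>(x, l). L x l)"
    and unique_primal: "\<And>xs ls x. (xs, ls) \<in> saddle_points X Y L \<Longrightarrow> x \<in> X \<Longrightarrow>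
          L x ls \<le> L xs ls \<Longrightarrow> x = xs"
    and saddle_exists: "saddle_points X Y L \<noteq> {}"
begin

lemma saddleD:
  assumes "(xs, ls) \<in> saddle_points X Y L"
  shows "xs \<in> X" "ls \<in> Y" "\<And>m. m \<in> Y \<Longrightarrow> L xs m \<le> L xs ls" "\<And>y. y \<in> X \<Longrightarrow> L xs ls \<le> L y ls"
  using assms by (auto simp: saddle_points_def)

lemma primal_rhs_inner_le:
  assumes "x' \<in> primal_rhs D X L x l" "x \<in> X" "y \<in> X"
  shows "(x - y) \<bullet> x' \<le> L y l - L x l"
proof -
  obtain v where v: "v \<in> subdifferential D (\<lambda>y. L y l) x" "x' = proj_tangent X x (- v)"
    using assms(1) by (auto simp: primal_rhs_def)
  have "L x l + v \<bullet> (y - x) \<le> L y l"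
    using v(1) assms(3) X_subset_D by (auto simp: subdifferential_def)
  moreover have "- v \<bullet> (y - x) \<le> x' \<bullet> (y - x)"
    unfolding v(2) by (rule proj_tangent_variational[OF convex_X assms(2,3)])
  ultimately show ?thesis by (simp add: inner_diff_left inner_diff_right inner_commute)
qed

lemma dual_rhs_inner_le:
  assumes "l' \<in> dual_rhs Y L x l" "l \<in> Y" "m \<in> Y"
  shows "(l - m) \<bullet> l' \<le> L x l - L x m"
proof -
  obtain v where v: "v \<in> subdifferential UNIV (\<lambda>m. - L x m) l" "l' = proj_tangent Y l (- v)"
    using assms(1) by (auto simp: dual_rhs_def)
  have "- L x l + v \<bullet> (m - l) \<le> - L x m"
    using v(1) by (auto simp: subdifferential_def)
  moreover have "- v \<bullet> (m - l) \<le> l' \<bullet> (m - l)"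
    unfolding v(2) by (rule proj_tangent_variational[OF convex_Y assms(2,3)])
  ultimately show ?thesis by (simp add: inner_diff_left inner_diff_right inner_commute)
qed

text \<open>
  With zero velocity the inner products in the two preceding bounds vanish, and what is left are the
  two saddle inequalities.
\<close>

lemma equilibrium_is_saddle_point:
  assumes "is_equilibrium D X Y L p"
  shows "p \<in> saddle_points X Y L"
proof -
  obtain x l where p: "p = (x, l)" by force
  have eq: "x \<in> X" "l \<in> Y" "0 \<in> primal_rhs D X L x l" "0 \<in> dual_rhs Y L x l"
    using assms by (auto simp: is_equilibrium_def p)
  show ?thesis
    using primal_rhs_inner_le[OF eq(3,1)] dual_rhs_inner_le[OF eq(4,2)] eq(1,2)
    by (auto simp: saddle_points_def p)
qed

end

locale saddle_flow_solution = saddle_flow D X Y L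
  for D X :: "'a::euclidean_space set" and Y :: "'b::euclidean_space set" and L :: "'a \<Rightarrow> 'b \<Rightarrow> real" +
  fixes x :: "real \<Rightarrow> 'a" and l :: "real \<Rightarrow> 'b"
  assumes solution: "is_solution D X Y L x l"
begin

lemma in_X: "t \<ge> 0 \<Longrightarrow> x t \<in> X" and in_Y: "t \<ge> 0 \<Longrightarrow> l t \<in> Y"
  using solution by (auto simp: is_solution_def)

lemma abs_cont:
  assumes "0 \<le> a"
  shows "absolutely_continuous_on_interval a b x" "absolutely_continuous_on_interval a b l"
proof -
  have "absolutely_continuous_on_interval 0 (max 0 b) x" "absolutely_continuous_on_interval 0 (max 0 b) l"
    using solution unfolding is_solution_def by auto
  then show "absolutely_continuous_on_interval a b x" "absolutely_continuous_on_interval a b l"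
    using assms by (auto elim!: absolutely_continuous_on_interval_subset)
qed

lemma inclusion_off_null_set:
  obtains N where "negligible N"
    "\<And>a b t. 0 \<le> a \<Longrightarrow> t \<in> {a..b} \<Longrightarrow> t \<notin> N \<Longrightarrow> \<exists>x' l'.
       (x has_vector_derivative x') (at t within {a..b}) \<and>
       (l has_vector_derivative l') (at t within {a..b}) \<and>
       x' \<in> primal_rhs D X L (x t) (l t) \<and> l' \<in> dual_rhs Y L (x t) (l t)"
proof -
  let ?P = "\<lambda>t. t \<ge> 0 \<longrightarrow> (\<exists>x' l'. (x has_vector_derivative x') (at t within {0..}) \<and>
                 (l has_vector_derivative l') (at t within {0..}) \<and>
                 x' \<in> primal_rhs D X L (x t) (l t) \<and> l' \<in> dual_rhs Y L (x t) (l t))"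
  have "AE t in lebesgue. ?P t" using solution unfolding is_solution_def by blast
  then obtain N where N0: "N \<in> null_sets lebesgue" "{t \<in> space lebesgue. \<not> ?P t} \<subseteq> N"
    unfolding eventually_ae_filter by blast
  have P: "?P t" if "t \<notin> N" for t using N0(2) that by auto
  show ?thesis
  proof (rule that)
    show "negligible N" using N0(1) by (simp add: negligible_iff_null_sets)
  next
    fix a b t :: real assume t: "0 \<le> a" "t \<in> {a..b}" "t \<notin> N"
    then have sub: "{a..b} \<subseteq> {0..}" and "t \<ge> 0" by auto
    then obtain x' l' where d: "(x has_vector_derivative x') (at t within {0..})"
       "(l has_vector_derivative l') (at t within {0..})"
       "x' \<in> primal_rhs D X L (x t) (l t)" "l' \<in> dual_rhs Y L (x t) (l t)"
      using P[OF t(3)] by blast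
    show "\<exists>x' l'. (x has_vector_derivative x') (at t within {a..b}) \<and>
       (l has_vector_derivative l') (at t within {a..b}) \<and>
       x' \<in> primal_rhs D X L (x t) (l t) \<and> l' \<in> dual_rhs Y L (x t) (l t)"
      using d(3,4) d(1,2)[THEN has_vector_derivative_within_subset, OF sub] by blast
  qed
qed

text \<open>
  The two bounds on the velocities add up, and \<open>L (x t) (l t)\<close> cancels.
\<close>

lemma dist_rate:
  assumes "y \<in> X" "m \<in> Y" "0 \<le> a" "a \<le> b"
    and c: "\<And>t. t \<in> {a..b} \<Longrightarrow> L y (l t) - L (x t) m \<le> c"
  shows "(dist (x b, l b) (y, m))\<^sup>2 / 2 - (dist (x a, l a) (y, m))\<^sup>2 / 2 \<le> c * (b - a)"
proof -
  obtain N where N: "negligible N"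
    "\<And>a b t. 0 \<le> a \<Longrightarrow> t \<in> {a..b} \<Longrightarrow> t \<notin> N \<Longrightarrow> \<exists>x' l'.
       (x has_vector_derivative x') (at t within {a..b}) \<and>
       (l has_vector_derivative l') (at t within {a..b}) \<and>
       x' \<in> primal_rhs D X L (x t) (l t) \<and> l' \<in> dual_rhs Y L (x t) (l t)"
    by (rule inclusion_off_null_set) blast
  have "((norm (x b - y))\<^sup>2 / 2 + (norm (l b - m))\<^sup>2 / 2) - ((norm (x a - y))\<^sup>2 / 2 + (norm (l a - m))\<^sup>2 / 2)
       \<le> c * (b - a)"
  proof (rule absolutely_continuous_half_norm_sq_le[OF abs_cont(1) abs_cont(2) \<open>a \<le> b\<close> N(1)])
    fix t assume t: "t \<in> {a..b}" "t \<notin> N"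
    then obtain x' l' where d: "(x has_vector_derivative x') (at t within {a..b})"
       "(l has_vector_derivative l') (at t within {a..b})"
       "x' \<in> primal_rhs D X L (x t) (l t)" "l' \<in> dual_rhs Y L (x t) (l t)"
      using N(2)[OF assms(3)] by blast
    have "t \<ge> 0" using t assms(3) by simp
    then have "(x t - y) \<bullet> x' + (l t - m) \<bullet> l' \<le> c"
      using primal_rhs_inner_le[OF d(3) in_X assms(1)] dual_rhs_inner_le[OF d(4) in_Y assms(2)] c[OF t(1)]
      by linarith
    then show "\<exists>u' v'. (x has_vector_derivative u') (at t within {a..b}) \<and>
          (l has_vector_derivative v') (at t within {a..b}) \<and> (x t - y) \<bullet> u' + (l t - m) \<bullet> v' \<le> c"
      using d by blast
  qed (use assms in auto)
  moreover have "(dist (x t, l t) (y, m))\<^sup>2 / 2 = (norm (x t - y))\<^sup>2 / 2 + (norm (l t - m))\<^sup>2 / 2" for t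
    by (simp add: dist_Pair_Pair add_divide_distrib) (simp add: dist_norm)
  ultimately show ?thesis by (simp only:)
qed

lemma primal_dist_rate:
  assumes "y \<in> X" "0 \<le> a" "a \<le> b"
    and c: "\<And>t. t \<in> {a..b} \<Longrightarrow> L y (l t) - L (x t) (l t) \<le> c"
  shows "(dist (x b) y)\<^sup>2 / 2 - (dist (x a) y)\<^sup>2 / 2 \<le> c * (b - a)"
proof -
  obtain N where N: "negligible N"
    "\<And>a b t. 0 \<le> a \<Longrightarrow> t \<in> {a..b} \<Longrightarrow> t \<notin> N \<Longrightarrow> \<exists>x' l'.
       (x has_vector_derivative x') (at t within {a..b}) \<and>
       (l has_vector_derivative l') (at t within {a..b}) \<and>
       x' \<in> primal_rhs D X L (x t) (l t) \<and> l' \<in> dual_rhs Y L (x t) (l t)"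
    by (rule inclusion_off_null_set) blast
  have "(norm (x b - y))\<^sup>2 / 2 - (norm (x a - y))\<^sup>2 / 2 \<le> c * (b - a)"
  proof (rule absolutely_continuous_derivative_le[OF absolutely_continuous_half_norm_sq[OF abs_cont(1)]
        \<open>a \<le> b\<close> N(1)])
    fix t assume t: "t \<in> {a..b}" "t \<notin> N"
    then obtain x' where d: "(x has_vector_derivative x') (at t within {a..b})"
       "x' \<in> primal_rhs D X L (x t) (l t)"
      using N(2)[OF assms(2)] by blast
    have "t \<ge> 0" using t assms(2) by simp
    then have "(x t - y) \<bullet> x' \<le> c"
      using primal_rhs_inner_le[OF d(2) in_X assms(1)] c[OF t(1)] by linarith
    then show "\<exists>u'\<le>c. ((\<lambda>t. (norm (x t - y))\<^sup>2 / 2) has_vector_derivative u') (at t within {a..b})"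
      using half_norm_sq_has_vector_derivative[OF d(1)] by blast
  qed (use assms in auto)
  then show ?thesis by (simp add: dist_norm)
qed

end

context saddle_flow_solution
begin

text \<open>
  This is both the stability estimate and the source of boundedness.
\<close>

lemma dist_saddle_nonincreasing:
  assumes "p \<in> saddle_points X Y L" "0 \<le> s" "s \<le> t"
  shows "dist (x t, l t) p \<le> dist (x s, l s) p"
proof -
  obtain xs ls where p: "p = (xs, ls)" by force
  note S = saddleD[OF assms(1)[unfolded p]]
  have "(dist (x t, l t) (xs, ls))\<^sup>2 / 2 - (dist (x s, l s) (xs, ls))\<^sup>2 / 2 \<le> 0 * (t - s)"
  proof (rule dist_rate[OF S(1,2) assms(2,3)])
    fix r assume "r \<in> {s..t}"
    then have "r \<ge> 0" using assms(2) by simp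
    then show "L xs (l r) - L (x r) ls \<le> 0" using S(3)[OF in_Y] S(4)[OF in_X] by force
  qed
  then have "(dist (x t, l t) p)\<^sup>2 \<le> (dist (x s, l s) p)\<^sup>2" by (simp add: p)
  then show ?thesis using power2_le_imp_le zero_le_dist by blast
qed

text \<open>
  The solution stays in a compact set, so the subgradients are bounded, and projection onto a tangent
  cone does not increase norms.
\<close>

lemma lipschitz:
  obtains C where "C > 0" "\<And>s t. 0 \<le> s \<Longrightarrow> s \<le> t \<Longrightarrow> dist (x t, l t) (x s, l s) \<le> C * (t - s)"
proof -
  obtain xs ls where p: "(xs, ls) \<in> saddle_points X Y L" using saddle_exists by auto
  define R where "R = dist (x 0, l 0) (xs, ls)"
  have lR: "l t \<in> cball ls R" if "t \<ge> 0" for t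
    using dist_saddle_nonincreasing[OF p order_refl that] dist_snd_le[of "(x t, l t)" "(xs, ls)"]
    by (simp add: R_def dist_commute)
  obtain B where B: "\<And>a m v. a \<in> X \<Longrightarrow> m \<in> cball ls R \<Longrightarrow> v \<in> subdifferential D (\<lambda>y. L y m) a \<Longrightarrow> norm v \<le> B"
  proof (rule subdifferential_bounded_on_compact[OF compact_X X_subset_D open_D compact_cball[of ls R]])
    show "continuous_on (D \<times> cball ls R) (\<lambda>(y, m). L y m)"
      by (rule continuous_on_subset[OF continuous_L]) auto
  qed blast
  have swap: "continuous_on (UNIV \<times> X) (\<lambda>(m, a). - L a m)"
  proof -
    have "continuous_on (UNIV \<times> X) (\<lambda>z. - (case (snd z, fst z) of (a, m) \<Rightarrow> L a m))"
      using X_subset_D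
      by (intro continuous_on_minus continuous_on_compose2[OF continuous_L] continuous_intros) auto
    then show ?thesis by (simp add: case_prod_unfold)
  qed
  obtain B' where B': "\<And>m a v. m \<in> cball ls R \<Longrightarrow> a \<in> X \<Longrightarrow> v \<in> subdifferential UNIV (\<lambda>m. - L a m) m \<Longrightarrow> norm v \<le> B'"
    by (rule subdifferential_bounded_on_compact[OF compact_cball[of ls R] _ open_UNIV compact_X swap]) auto
  obtain N where N: "negligible N"
    "\<And>a b t. 0 \<le> a \<Longrightarrow> t \<in> {a..b} \<Longrightarrow> t \<notin> N \<Longrightarrow> \<exists>x' l'.
       (x has_vector_derivative x') (at t within {a..b}) \<and>
       (l has_vector_derivative l') (at t within {a..b}) \<and>
       x' \<in> primal_rhs D X L (x t) (l t) \<and> l' \<in> dual_rhs Y L (x t) (l t)"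
    by (rule inclusion_off_null_set) blast
  have bound: "norm x' \<le> B \<and> norm l' \<le> B'"
    if t: "t \<ge> 0" and rhs: "x' \<in> primal_rhs D X L (x t) (l t)" "l' \<in> dual_rhs Y L (x t) (l t)" for t x' l'
  proof -
    obtain v where v: "v \<in> subdifferential D (\<lambda>y. L y (l t)) (x t)" "x' = proj_tangent X (x t) (- v)"
      using rhs(1) by (auto simp: primal_rhs_def)
    obtain w where w: "w \<in> subdifferential UNIV (\<lambda>m. - L (x t) m) (l t)" "l' = proj_tangent Y (l t) (- w)"
      using rhs(2) by (auto simp: dual_rhs_def)
    show ?thesis
      using norm_proj_tangent_le[OF convex_X in_X, of t "- v"] B[OF in_X lR v(1)]
        norm_proj_tangent_le[OF convex_Y in_Y, of t "- w"] B'[OF lR in_X w(1)] t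
      by (auto simp: v(2) w(2))
  qed
  have X: "norm (x t - x s) \<le> B * (t - s)" if "0 \<le> s" "s \<le> t" for s t
  proof (rule absolutely_continuous_derivative_norm_le[OF abs_cont(1) that(2) N(1)])
    fix r assume r: "r \<in> {s..t}" "r \<notin> N"
    then have "r \<ge> 0" using that by auto
    then show "\<exists>u'. norm u' \<le> B \<and> (x has_vector_derivative u') (at r within {s..t})"
      using N(2)[OF that(1) r] bound by blast
  qed (rule that)
  have Y: "norm (l t - l s) \<le> B' * (t - s)" if "0 \<le> s" "s \<le> t" for s t
  proof (rule absolutely_continuous_derivative_norm_le[OF abs_cont(2) that(2) N(1)])
    fix r assume r: "r \<in> {s..t}" "r \<notin> N"
    then have "r \<ge> 0" using that by auto
    then show "\<exists>u'. norm u' \<le> B' \<and> (l has_vector_derivative u') (at r within {s..t})"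
      using N(2)[OF that(1) r] bound by blast
  qed (rule that)
  show ?thesis
  proof (rule that)
    show "\<bar>B\<bar> + \<bar>B'\<bar> + 1 > 0" by simp
  next
    fix s t :: real assume st: "0 \<le> s" "s \<le> t"
    have "dist (x t, l t) (x s, l s) \<le> dist (x t) (x s) + dist (l t) (l s)"
      unfolding dist_Pair_Pair by (rule sqrt_sum_squares_le_sum) auto
    also have "\<dots> \<le> B * (t - s) + B' * (t - s)" using X[OF st] Y[OF st] by (simp add: dist_norm)
    also have "\<dots> = (B + B') * (t - s)" by (simp add: algebra_simps)
    also have "\<dots> \<le> (\<bar>B\<bar> + \<bar>B'\<bar> + 1) * (t - s)" using st by (intro mult_right_mono) auto
    finally show "dist (x t, l t) (x s, l s) \<le> (\<bar>B\<bar> + \<bar>B'\<bar> + 1) * (t - s)" .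
  qed
qed

text \<open>
  Barbalat's argument: half the squared distance to the saddle point decreases at least at the
  rate of the gap and is bounded below, while the gap is uniformly continuous along the solution.
\<close>

lemma gap_tendsto_0:
  assumes p: "(xs, ls) \<in> saddle_points X Y L"
  shows "((\<lambda>t. L (x t) ls - L xs (l t)) \<longlongrightarrow> 0) at_top"
proof -
  note S = saddleD[OF p]
  define W where "W = (\<lambda>z. L (fst z) ls - L xs (snd z))"
  have W0: "W (x t, l t) \<ge> 0" if "t \<ge> 0" for t
    using S(3)[OF in_Y] S(4)[OF in_X] that by (force simp: W_def)
  define q where "q t = (dist (x t, l t) (xs, ls))\<^sup>2 / 2" for t
  have q_mono: "q t \<le> q s" if "0 \<le> s" "s \<le> t" for s t
    using dist_saddle_nonincreasing[OF p that] by (simp add: q_def power_mono)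
  have q0: "q t \<ge> 0" for t by (simp add: q_def)
  define R where "R = dist (x 0, l 0) (xs, ls)"
  have lR: "(x t, l t) \<in> X \<times> cball ls R" if "t \<ge> 0" for t
    using dist_saddle_nonincreasing[OF p order_refl that] dist_snd_le[of "(x t, l t)" "(xs, ls)"] in_X[OF that]
    by (simp add: R_def dist_commute)
  have "continuous_on (X \<times> cball ls R) W"
  proof -
    have "continuous_on (X \<times> cball ls R) (\<lambda>z. (case (fst z, ls) of (a, m) \<Rightarrow> L a m) - (case (xs, snd z) of (a, m) \<Rightarrow> L a m))"
      using X_subset_D S(1)
      by (intro continuous_on_diff continuous_on_compose2[OF continuous_L] continuous_intros) auto
    then show ?thesis by (simp add: W_def)
  qed
  then have unif: "uniformly_continuous_on (X \<times> cball ls R) W"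
    by (intro compact_uniformly_continuous compact_Times compact_X compact_cball)
  obtain C where C: "C > 0" "\<And>s t. 0 \<le> s \<Longrightarrow> s \<le> t \<Longrightarrow> dist (x t, l t) (x s, l s) \<le> C * (t - s)"
    by (rule lipschitz) blast
  have "\<exists>T. \<forall>t\<ge>T. \<bar>W (x t, l t)\<bar> < \<epsilon>" if "\<epsilon> > 0" for \<epsilon>
  proof -
    obtain d where d: "d > 0" "\<And>z z'. z \<in> X \<times> cball ls R \<Longrightarrow> z' \<in> X \<times> cball ls R \<Longrightarrow> dist z' z < d \<Longrightarrow>
       dist (W z') (W z) < \<epsilon> / 2"
      using unif \<open>\<epsilon> > 0\<close> unfolding uniformly_continuous_on_def by (metis half_gt_zero)
    define \<eta> where "\<eta> = d / (2 * C)"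
    have \<eta>: "\<eta> > 0" "C * \<eta> < d" using d(1) C(1) by (auto simp: \<eta>_def)
    define I where "I = Inf (q ` {0..})"
    have bdd: "bdd_below (q ` {0..})" using q0 by (auto intro!: bdd_belowI)
    have "I < I + \<epsilon> / 2 * \<eta>" using \<open>\<epsilon> > 0\<close> \<eta>(1) by simp
    then obtain T where T: "T \<ge> 0" "q T < I + \<epsilon> / 2 * \<eta>"
      unfolding I_def using cInf_lessD[of "q ` {0..}"] by fastforce
    have "\<bar>W (x t, l t)\<bar> < \<epsilon>" if "t \<ge> T" for t
    proof (rule ccontr)
      assume "\<not> ?thesis"
      have t: "t \<ge> 0" using that T by simp
      have Wt: "W (x t, l t) \<ge> \<epsilon>" using \<open>\<not> _\<close> W0[OF t] by simp
      \<comment> \<open>The gap changes slowly, so it stays above half its value for a time \<open>\<eta>\<close>, and half the squared distance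
        to the saddle point drops by more than what is left to drop.\<close>
      have "q (t + \<eta>) - q t \<le> (- (\<epsilon> / 2)) * ((t + \<eta>) - t)"
        unfolding q_def
      proof (rule dist_rate[OF S(1,2) t])
        fix s assume s: "s \<in> {t..t + \<eta>}"
        have "dist (x s, l s) (x t, l t) \<le> C * (s - t)" using C(2)[OF t] s by simp
        also have "\<dots> \<le> C * \<eta>" using s C(1) by simp
        finally have "dist (W (x s, l s)) (W (x t, l t)) < \<epsilon> / 2"
          using \<eta>(2) t s by (intro d(2) lR) auto
        then have "W (x s, l s) > \<epsilon> / 2" using Wt unfolding dist_real_def by linarith
        then show "L xs (l s) - L (x s) ls \<le> - (\<epsilon> / 2)" by (simp add: W_def)
      qed (use \<eta> in simp)
      moreover have "I \<le> q (t + \<eta>)" unfolding I_def using t \<eta>(1) by (intro cInf_lower bdd) auto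
      moreover have "q t \<le> q T" using q_mono[OF T(1) that] .
      ultimately show False using T(2) by simp
    qed
    then show ?thesis by blast
  qed
  then show ?thesis
    unfolding tendsto_iff eventually_at_top_linorder by (simp add: W_def dist_real_def)
qed

text \<open>
  The gap dominates \<open>L (x t) ls - L xs ls\<close>, which is bounded away from 0 outside any neighbourhood of
  the unique minimizer because \<open>X\<close> is compact.
\<close>

lemma primal_tendsto:
  assumes p: "(xs, ls) \<in> saddle_points X Y L"
  shows "(x \<longlongrightarrow> xs) at_top"
proof (rule tendstoI)
  note S = saddleD[OF p]
  fix e :: real assume "e > 0"
  define A where "A = X - ball xs e"
  show "eventually (\<lambda>t. dist (x t) xs < e) at_top"
  proof (cases "A = {}")
    case True
    have "dist (x t) xs < e" if "t \<ge> 0" for t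
      using in_X[OF that] True by (auto simp: A_def dist_commute)
    then show ?thesis unfolding eventually_at_top_linorder by blast
  next
    case False
    have "continuous_on A (\<lambda>y. case (y, ls) of (a, m) \<Rightarrow> L a m)"
      using X_subset_D unfolding A_def
      by (intro continuous_on_compose2[OF continuous_L] continuous_intros) auto
    moreover have "compact A" unfolding A_def by (intro compact_diff compact_X) auto
    ultimately obtain y where y: "y \<in> A" "\<And>z. z \<in> A \<Longrightarrow> L y ls \<le> L z ls"
      using continuous_attains_inf[OF _ False] by (metis (no_types, lifting) case_prod_conv)
    have "y \<in> X" "y \<noteq> xs" using y(1) \<open>e > 0\<close> by (auto simp: A_def)
    then have "L xs ls < L y ls" using unique_primal[OF p] by force
    then have "eventually (\<lambda>t. dist (L (x t) ls - L xs (l t)) 0 < L y ls - L xs ls) at_top"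
      by (intro tendstoD[OF gap_tendsto_0[OF p]]) simp
    then show ?thesis using eventually_ge_at_top[of 0]
    proof eventually_elim
      case (elim t)
      have "L xs (l t) \<le> L xs ls" using S(3)[OF in_Y[OF elim(2)]] .
      then have "L (x t) ls < L y ls" using elim(1) by (simp add: dist_real_def)
      then have "x t \<notin> A" using y(2) by force
      then show ?case using in_X[OF elim(2)] by (auto simp: A_def dist_commute)
    qed
  qed
qed

text \<open>
  The dual inequality follows from the vanishing gap by continuity. If the primal one failed at
  \<open>y\<close>, the distance from \<open>x\<close> to \<open>y\<close> would shrink by a fixed amount over each window
  \<open>[r n, r n + \<tau>]\<close>, because \<open>l\<close> moves too slowly to leave the neighbourhood of \<open>lh\<close>;
  but \<open>x\<close> converges.
\<close>

lemma cluster_point_is_saddle_point: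
  assumes p: "(xs, ls) \<in> saddle_points X Y L"
    and r: "filterlim r at_top sequentially" and lim: "(\<lambda>n. l (r n)) \<longlonglongrightarrow> lh"
  shows "(xs, lh) \<in> saddle_points X Y L"
proof -
  note S = saddleD[OF p]
  have r0: "eventually (\<lambda>n. r n \<ge> 0) sequentially" using r by (simp add: filterlim_at_top)
  have lh: "lh \<in> Y"
    by (rule Lim_in_closed_set[OF closed_Y eventually_mono[OF r0 in_Y] _ lim]) auto
  have cont: "continuous_on (D \<times> UNIV) (\<lambda>(a, m). L a m)" by (rule continuous_L)
  have xs: "xs \<in> D" using S(1) X_subset_D by blast
  have cont_l: "isCont (\<lambda>m. L y m) m" if "y \<in> D" for y m
  proof -
    have "continuous_on UNIV (\<lambda>m. case (y, m) of (a, m) \<Rightarrow> L a m)"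
      using that by (intro continuous_on_compose2[OF cont] continuous_intros) auto
    then show ?thesis by (simp add: continuous_on_eq_continuous_at)
  qed
  have x_lim: "(\<lambda>n. x (r n)) \<longlonglongrightarrow> xs" by (rule filterlim_compose[OF primal_tendsto[OF p] r])
  have gap: "(\<lambda>n. L (x (r n)) ls - L xs (l (r n))) \<longlonglongrightarrow> 0"
    by (rule filterlim_compose[OF gap_tendsto_0[OF p] r])
  have "(\<lambda>n. L xs (l (r n))) \<longlonglongrightarrow> L xs lh" by (rule isCont_tendsto_compose[OF cont_l[OF xs] lim])
  from tendsto_add[OF gap this] have "(\<lambda>n. L (x (r n)) ls) \<longlonglongrightarrow> L xs lh" by simp
  then have "L xs ls \<le> L xs lh"
    by (rule tendsto_lowerbound) (use r0 S(4) in \<open>auto elim!: eventually_mono intro: in_X\<close>)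
  then have dual: "\<And>m. m \<in> Y \<Longrightarrow> L xs m \<le> L xs lh" using S(3) by force
  obtain C where C: "C > 0" "\<And>s t. 0 \<le> s \<Longrightarrow> s \<le> t \<Longrightarrow> dist (x t, l t) (x s, l s) \<le> C * (t - s)"
    by (rule lipschitz) blast
  have "L xs lh \<le> L y lh" if y: "y \<in> X" for y
  proof (rule ccontr)
    assume "\<not> ?thesis"
    define \<epsilon> where "\<epsilon> = (L xs lh - L y lh) / 2"
    have "\<epsilon> > 0" using \<open>\<not> _\<close> by (simp add: \<epsilon>_def)
    have "continuous_on (D \<times> UNIV) (\<lambda>z. (case (y, snd z) of (a, m) \<Rightarrow> L a m) - (case z of (a, m) \<Rightarrow> L a m))"
      using y X_subset_D
      by (intro continuous_on_diff continuous_on_compose2[OF cont] cont continuous_intros) auto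
    then have "continuous (at (xs, lh)) (\<lambda>z. L y (snd z) - L (fst z) (snd z))"
      using continuous_on_interior[of "D \<times> UNIV" _ "(xs, lh)"] xs open_D
      by (simp add: case_prod_unfold interior_Times interior_open)
    then obtain d where d: "d > 0" "\<And>z. dist z (xs, lh) < d \<Longrightarrow>
       dist (L y (snd z) - L (fst z) (snd z)) (L y lh - L xs lh) < \<epsilon>"
      using \<open>\<epsilon> > 0\<close> unfolding continuous_at_eps_delta by (metis fst_conv snd_conv)
    define \<tau> where "\<tau> = d / (4 * C)"
    have \<tau>: "\<tau> > 0" "C * \<tau> < d / 2" using d(1) C(1) by (auto simp: \<tau>_def)
    have "((\<lambda>n. (x (r n), l (r n))) \<longlonglongrightarrow> (xs, lh))" by (rule tendsto_Pair[OF x_lim lim])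
    then have "eventually (\<lambda>n. dist (x (r n), l (r n)) (xs, lh) < d / 2) sequentially"
      by (rule tendstoD) (use d in simp)
    \<comment> \<open>Over the time \<open>\<tau>\<close> the state stays near \<open>(xs, lh)\<close>, so \<open>x\<close> approaches \<open>y\<close> at a definite rate.\<close>
    then have "eventually (\<lambda>n. (dist (x (r n + \<tau>)) y)\<^sup>2 / 2 - (dist (x (r n)) y)\<^sup>2 / 2 \<le> - \<epsilon> * \<tau>) sequentially"
      using r0
    proof eventually_elim
      case (elim n)
      have "(dist (x (r n + \<tau>)) y)\<^sup>2 / 2 - (dist (x (r n)) y)\<^sup>2 / 2 \<le> (- \<epsilon>) * ((r n + \<tau>) - r n)"
      proof (rule primal_dist_rate[OF y elim(2)])
        fix t assume t: "t \<in> {r n..r n + \<tau>}"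
        have "dist (x t, l t) (x (r n), l (r n)) \<le> C * (t - r n)" using C(2)[OF elim(2)] t by simp
        also have "\<dots> \<le> C * \<tau>" using t C(1) by simp
        finally have near: "dist (x t, l t) (xs, lh) < d"
          using dist_triangle[of "(x t, l t)" "(xs, lh)" "(x (r n), l (r n))"] \<tau>(2) elim(1) by linarith
        have "L y lh - L xs lh = - 2 * \<epsilon>" by (simp add: \<epsilon>_def)
        with d(2)[OF near] show "L y (l t) - L (x t) (l t) \<le> - \<epsilon>"
          unfolding dist_real_def fst_conv snd_conv by linarith
      qed (use \<tau> in simp)
      then show ?case by simp
    qed
    moreover have "(\<lambda>n. (dist (x (r n + \<tau>)) y)\<^sup>2 / 2 - (dist (x (r n)) y)\<^sup>2 / 2)
        \<longlonglongrightarrow> (dist xs y)\<^sup>2 / 2 - (dist xs y)\<^sup>2 / 2"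
    proof -
      have "filterlim (\<lambda>n. r n + \<tau>) at_top sequentially"
        using filterlim_tendsto_add_at_top[OF tendsto_const[of \<tau>] r] by (simp add: add.commute)
      from filterlim_compose[OF primal_tendsto[OF p] this] x_lim show ?thesis
        by (intro tendsto_intros) auto
    qed
    ultimately have "(dist xs y)\<^sup>2 / 2 - (dist xs y)\<^sup>2 / 2 \<le> - \<epsilon> * \<tau>"
      by (intro tendsto_upperbound) auto
    then show False using mult_pos_pos[OF \<open>\<epsilon> > 0\<close> \<tau>(1)] by simp
  qed
  then show ?thesis using S(1) lh dual by (auto simp: saddle_points_def)
qed

text \<open>
  The distance to a saddle point that is a cluster point is nonincreasing and comes
  arbitrarily close to 0.
\<close>

lemma converges_to_saddle_point:
  shows "\<exists>p \<in> saddle_points X Y L. ((\<lambda>t. (x t, l t)) \<longlongrightarrow> p) at_top"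
proof -
  obtain xs ls where p: "(xs, ls) \<in> saddle_points X Y L" using saddle_exists by auto
  define R where "R = dist (x 0, l 0) (xs, ls)"
  have lR: "l (real n) \<in> cball ls R" for n
    using dist_saddle_nonincreasing[OF p order_refl, of "real n"] dist_snd_le[of "(x n, l n)" "(xs, ls)"]
    by (simp add: R_def dist_commute)
  obtain lh k where k: "strict_mono k" "((\<lambda>n. l (real n)) \<circ> k) \<longlonglongrightarrow> lh"
    using compact_cball[of ls R, unfolded compact_def, THEN spec, of "\<lambda>n. l (real n)"] lR by blast
  define r where "r n = real (k n)" for n
  have r: "filterlim r at_top sequentially" unfolding r_def
    by (rule filterlim_compose[OF filterlim_real_sequentially filterlim_subseq[OF k(1)]])
  have lim: "(\<lambda>n. l (r n)) \<longlonglongrightarrow> lh" using k(2) by (simp add: r_def o_def)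
  have ph: "(xs, lh) \<in> saddle_points X Y L" by (rule cluster_point_is_saddle_point[OF p r lim])
  have zlim: "(\<lambda>n. (x (r n), l (r n))) \<longlonglongrightarrow> (xs, lh)"
    by (intro tendsto_Pair lim filterlim_compose[OF primal_tendsto[OF p] r])
  have "((\<lambda>t. (x t, l t)) \<longlongrightarrow> (xs, lh)) at_top"
  proof (rule tendstoI)
    fix e :: real assume "e > 0"
    from tendstoD[OF zlim this] obtain n where n: "dist (x (r n), l (r n)) (xs, lh) < e"
      by (auto simp: eventually_sequentially)
    have "dist (x t, l t) (xs, lh) < e" if "t \<ge> r n" for t
      using dist_saddle_nonincreasing[OF ph _ that] n by (simp add: r_def)
    then show "eventually (\<lambda>t. dist (x t, l t) (xs, lh) < e) at_top"
      unfolding eventually_at_top_linorder by blast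
  qed
  then show ?thesis using ph by blast
qed

end

context saddle_flow
begin

lemma saddle_point_lyapunov_stable:
  assumes "p \<in> saddle_points X Y L"
  shows "lyapunov_stable D X Y L p"
  unfolding lyapunov_stable_def
proof (intro allI impI)
  fix \<epsilon> :: real assume "\<epsilon> > 0"
  show "\<exists>\<delta>>0. \<forall>x l. is_solution D X Y L x l \<longrightarrow> dist (x 0, l 0) p < \<delta> \<longrightarrow> (\<forall>t\<ge>0. dist (x t, l t) p < \<epsilon>)"
  proof (intro exI[of _ \<epsilon>] conjI \<open>\<epsilon> > 0\<close> allI impI)
    fix x l and t :: real assume "is_solution D X Y L x l" "dist (x 0, l 0) p < \<epsilon>" "t \<ge> 0"
    then interpret saddle_flow_solution D X Y L x l by unfold_locales
    show "dist (x t, l t) p < \<epsilon>"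
      using dist_saddle_nonincreasing[OF assms order_refl \<open>t \<ge> 0\<close>] \<open>dist (x 0, l 0) p < \<epsilon>\<close> by simp
  qed
qed

end

section \<open>Lagrange multipliers and consensus on a connected graph\<close>

text \<open>
  Separates the set of attainable (constraint, cost) values, enlarged upwards, from the values that
  would be feasible and better than the lower bound \<open>p\<close>. Since both sets are monotone, the
  normal of the hyperplane is nonnegative.
\<close>

lemma slater_multiplier:
  fixes F :: "'a::real_vector \<Rightarrow> real" and G :: "'a \<Rightarrow> real ^ 'm::finite"
  assumes F: "convex_on X F" and G: "\<And>k. convex_on X (\<lambda>x. G x $ k)"
    and xbar: "xbar \<in> X" "\<And>k. G xbar $ k < 0"
    and p: "\<And>x. x \<in> X \<Longrightarrow> (\<And>k. G x $ k \<le> 0) \<Longrightarrow> p \<le> F x"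
  obtains \<mu> where "\<And>k. 0 \<le> \<mu> $ k" "\<And>x. x \<in> X \<Longrightarrow> p \<le> F x + \<mu> \<bullet> G x"
proof -
  define A where "A = {z :: (real ^ 'm) \<times> real. \<exists>x\<in>X. (\<forall>k. G x $ k \<le> fst z $ k) \<and> F x \<le> snd z}"
  define B where "B = {z :: (real ^ 'm) \<times> real. (\<forall>k. fst z $ k \<le> 0) \<and> snd z < p}"
  have "convex X" using F by (simp add: convex_on_def)
  have "convex A"
    unfolding convex_def
  proof (intro ballI allI impI)
    fix z w :: "(real ^ 'm) \<times> real" and u v :: real
    assume "z \<in> A" "w \<in> A" and uv: "0 \<le> u" "0 \<le> v" "u + v = 1"
    then obtain x y where x: "x \<in> X" "\<And>k. G x $ k \<le> fst z $ k" "F x \<le> snd z"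
      and y: "y \<in> X" "\<And>k. G y $ k \<le> fst w $ k" "F y \<le> snd w" by (auto simp: A_def)
    have "u *\<^sub>R x + v *\<^sub>R y \<in> X" using \<open>convex X\<close> x(1) y(1) uv by (simp add: convexD)
    moreover have "G (u *\<^sub>R x + v *\<^sub>R y) $ k \<le> u * fst z $ k + v * fst w $ k" for k
    proof -
      have "G (u *\<^sub>R x + v *\<^sub>R y) $ k \<le> u * G x $ k + v * G y $ k"
        using G[of k] x(1) y(1) uv unfolding convex_on_def by blast
      also have "\<dots> \<le> u * fst z $ k + v * fst w $ k" by (intro add_mono mult_left_mono x y uv)
      finally show ?thesis .
    qed
    moreover have "F (u *\<^sub>R x + v *\<^sub>R y) \<le> u * snd z + v * snd w"
    proof -
      have "F (u *\<^sub>R x + v *\<^sub>R y) \<le> u * F x + v * F y"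
        using F x(1) y(1) uv unfolding convex_on_def by blast
      also have "\<dots> \<le> u * snd z + v * snd w" by (intro add_mono mult_left_mono x y uv)
      finally show ?thesis .
    qed
    ultimately show "u *\<^sub>R z + v *\<^sub>R w \<in> A" by (auto simp: A_def)
  qed
  have "convex B"
    unfolding convex_def
  proof (intro ballI allI impI)
    fix z w :: "(real ^ 'm) \<times> real" and u v :: real
    assume z: "z \<in> B" and w: "w \<in> B" and uv: "0 \<le> u" "0 \<le> v" "u + v = 1"
    have "u * snd z + v * snd w < p"
      by (rule convex_bound_lt) (use z w uv in \<open>auto simp: B_def\<close>)
    moreover have "u * fst z $ k + v * fst w $ k \<le> 0" for k
      using z w uv by (auto simp: B_def intro!: add_nonpos_nonpos mult_nonneg_nonpos)
    ultimately show "u *\<^sub>R z + v *\<^sub>R w \<in> B" by (simp add: B_def)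
  qed
  have "(G xbar, F xbar) \<in> A" using xbar(1) by (auto simp: A_def)
  moreover have "(0, p - 1) \<in> B" by (auto simp: B_def)
  moreover have "B \<inter> A = {}"
  proof -
    have False if z: "z \<in> A" "z \<in> B" for z
    proof -
      obtain x where x: "x \<in> X" "\<And>k. G x $ k \<le> fst z $ k" "F x \<le> snd z" using z(1) by (auto simp: A_def)
      have "G x $ k \<le> 0" for k using x(2)[of k] z(2) by (auto simp: B_def intro: order_trans)
      from p[OF x(1) this] x(3) z(2) show False by (simp add: B_def)
    qed
    then show ?thesis by blast
  qed
  ultimately obtain a b where a: "a \<noteq> 0" "\<And>z. z \<in> B \<Longrightarrow> a \<bullet> z \<le> b" "\<And>z. z \<in> A \<Longrightarrow> b \<le> a \<bullet> z"
    using separating_hyperplane_sets[OF \<open>convex B\<close> \<open>convex A\<close>] by blast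
  obtain \<mu> \<nu> where a_eq: "a = (\<mu>, \<nu>)" by force
  have inB: "\<mu> \<bullet> u + \<nu> * r \<le> b" if "\<And>k. u $ k \<le> 0" "r < p" for u r
    using a(2)[of "(u, r)"] that by (simp add: B_def a_eq)
  have inA: "b \<le> \<mu> \<bullet> G x + \<nu> * F x" if "x \<in> X" for x
    using a(3)[of "(G x, F x)"] that by (auto simp: A_def a_eq)
  have \<mu>: "0 \<le> \<mu> $ k" for k
  proof (rule ccontr)
    assume neg: "\<not> 0 \<le> \<mu> $ k"
    define s where "s = (\<bar>b - \<nu> * (p - 1)\<bar> + 1) / (- \<mu> $ k)"
    have "s \<ge> 0" unfolding s_def using neg by (intro divide_nonneg_nonneg) auto
    moreover have "s * (- \<mu> $ k) = \<bar>b - \<nu> * (p - 1)\<bar> + 1" using neg by (simp add: s_def)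
    ultimately have s: "s \<ge> 0" "s * (- \<mu> $ k) = \<bar>b - \<nu> * (p - 1)\<bar> + 1" by auto
    have "\<mu> \<bullet> (axis k (- s)) + \<nu> * (p - 1) \<le> b" using s(1) by (intro inB) (auto simp: axis_def)
    then show False using s(2) by (simp add: inner_axis algebra_simps)
  qed
  have \<nu>: "0 \<le> \<nu>"
  proof (rule ccontr)
    assume neg: "\<not> 0 \<le> \<nu>"
    define s where "s = (\<bar>b - \<nu> * p\<bar> + 1) / (- \<nu>)"
    have s: "s > 0" "s * (- \<nu>) = \<bar>b - \<nu> * p\<bar> + 1" using neg by (auto simp: s_def divide_pos_neg)
    have "\<mu> \<bullet> 0 + \<nu> * (p - s) \<le> b" using s(1) by (intro inB) auto
    then show False using s(2) by (simp add: algebra_simps)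
  qed
  have \<nu>p: "\<nu> * p \<le> b"
  proof (rule field_le_epsilon)
    fix e :: real assume "e > 0"
    have "\<mu> \<bullet> 0 + \<nu> * (p - e / (\<nu> + 1)) \<le> b" using \<open>e > 0\<close> \<nu> by (intro inB) (auto intro!: divide_pos_pos)
    then have "\<nu> * p \<le> b + \<nu> * (e / (\<nu> + 1))" by (simp add: algebra_simps)
    also have "\<nu> * (e / (\<nu> + 1)) \<le> e" using \<nu> \<open>e > 0\<close> by (simp add: field_simps)
    finally show "\<nu> * p \<le> b + e" by simp
  qed
  \<comment> \<open>The hyperplane is not vertical, because all components of \<open>G xbar\<close> are negative.\<close>
  have "\<nu> \<noteq> 0"
  proof
    assume "\<nu> = 0"
    then have "0 \<le> \<mu> \<bullet> G xbar" using inA[OF xbar(1)] \<nu>p by simp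
    then have "(\<Sum>k\<in>UNIV. \<mu> $ k * (- G xbar $ k)) \<le> 0" by (simp add: inner_vec_def sum_negf)
    moreover have nn: "0 \<le> \<mu> $ k * (- G xbar $ k)" for k using \<mu>[of k] xbar(2)[of k] by (simp add: mult_nonneg_nonpos less_imp_le)
    ultimately have "(\<Sum>k\<in>UNIV. \<mu> $ k * (- G xbar $ k)) = 0" by (intro antisym sum_nonneg) auto
    then have z: "\<mu> $ k * (- G xbar $ k) = 0" for k using nn by (subst (asm) sum_nonneg_eq_0_iff) auto
    have "\<mu> $ k = 0" for k using xbar(2)[of k] z[of k] by simp
    then have "\<mu> = 0" by (simp add: vec_eq_iff)
    then show False using a(1) \<open>\<nu> = 0\<close> by (simp add: a_eq zero_prod_def)
  qed
  then have "\<nu> > 0" using \<nu> by simp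
  show ?thesis
  proof (rule that)
    show "0 \<le> ((1 / \<nu>) *\<^sub>R \<mu>) $ k" for k using \<mu>[of k] \<nu> by simp
    fix x assume "x \<in> X"
    then have "\<nu> * p \<le> \<mu> \<bullet> G x + \<nu> * F x" using inA \<nu>p by force
    then show "p \<le> F x + ((1 / \<nu>) *\<^sub>R \<mu>) \<bullet> G x" using \<open>\<nu> > 0\<close> by (simp add: field_simps)
  qed
qed

text \<open>
  Each edge is counted in both directions, hence the factor 2. Instead of choosing a simple path
  from \<open>i\<close> to \<open>j\<close>, the bound is established on a growing set of nodes with the sum
  restricted to the edges inside: an edge that leaves the set adds a node and pays for it.
\<close>

lemma connected_edge_sum_bound:
  fixes d :: "'v::finite \<Rightarrow> 'v \<Rightarrow> real"
  assumes E: "sym E" "\<And>i j. (i, j) \<in> E\<^sup>*"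
    and d: "\<And>a b. 0 \<le> d a b" "\<And>a b. d a b = d b a" "\<And>a. d a a = 0" "\<And>a b c. d a c \<le> d a b + d b c"
  shows "2 * d i j \<le> (\<Sum>(a, b)\<in>E. d a b)"
proof -
  define P where "P S \<longleftrightarrow> i \<in> S \<and> (\<forall>a\<in>S. 2 * d i a \<le> (\<Sum>(a, b)\<in>E \<inter> S \<times> S. d a b))" for S
  have "P {i}" using d(1,3) by (auto simp: P_def intro!: sum_nonneg)
  moreover have "\<forall>S. P S \<longrightarrow> card S < Suc CARD('v)" by (simp add: card_mono less_Suc_eq_le)
  ultimately obtain S where S: "P S" "\<And>T. P T \<Longrightarrow> card T \<le> card S"
    using ex_has_greatest_nat[of P "{i}" card "Suc CARD('v)"] by blast
  have "S = UNIV"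
  proof (rule ccontr)
    assume "S \<noteq> UNIV"
    then obtain c where c: "c \<notin> S" by blast
    have "(i, c) \<in> E\<^sup>*" by (rule E)
    then have "c \<notin> S \<longrightarrow> (\<exists>a b. (a, b) \<in> E \<and> a \<in> S \<and> b \<notin> S)"
    proof (induction rule: rtrancl_induct)
      case base
      then show ?case using S(1) by (simp add: P_def)
    qed blast
    then obtain a b where ab: "(a, b) \<in> E" "a \<in> S" "b \<notin> S" using c by blast
    then have "a \<noteq> b" by blast
    let ?T = "insert b S"
    have sub: "(E \<inter> S \<times> S) \<union> {(a, b), (b, a)} \<subseteq> E \<inter> ?T \<times> ?T" using ab E(1) by (auto dest: symD)
    have "(\<Sum>(a, b)\<in>E \<inter> S \<times> S. d a b) + (d a b + d b a) = (\<Sum>(a, b)\<in>(E \<inter> S \<times> S) \<union> {(a, b), (b, a)}. d a b)"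
      using ab \<open>a \<noteq> b\<close> by (subst sum.union_disjoint) auto
    also have "\<dots> \<le> (\<Sum>(a, b)\<in>E \<inter> ?T \<times> ?T. d a b)" using sub d(1) by (intro sum_mono2) auto
    finally have step: "(\<Sum>(a, b)\<in>E \<inter> S \<times> S. d a b) + 2 * d a b \<le> (\<Sum>(a, b)\<in>E \<inter> ?T \<times> ?T. d a b)"
      using d(2)[of a b] by simp
    have "P ?T"
      unfolding P_def
    proof (intro conjI ballI)
      show "i \<in> ?T" using S(1) by (simp add: P_def)
      fix e assume "e \<in> ?T"
      then show "2 * d i e \<le> (\<Sum>(a, b)\<in>E \<inter> ?T \<times> ?T. d a b)"
      proof
        assume "e = b"
        moreover have "2 * d i a \<le> (\<Sum>(a, b)\<in>E \<inter> S \<times> S. d a b)" using S(1) ab(2) by (simp add: P_def)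
        ultimately show ?thesis using step d(4)[of i b a] by simp
      next
        assume "e \<in> S"
        then have "2 * d i e \<le> (\<Sum>(a, b)\<in>E \<inter> S \<times> S. d a b)" using S(1) by (simp add: P_def)
        then show ?thesis using step d(1)[of a b] by simp
      qed
    qed
    from S(2)[OF this] show False using ab(3) by simp
  qed
  then show ?thesis using S(1) by (simp add: P_def)
qed

lemma l1_norm_le_disagreement:
  assumes E: "sym E" "\<And>i j. (i, j) \<in> E\<^sup>*"
  shows "l1_norm (l $ i - l $ j) \<le> disagreement E l"
proof -
  have "2 * l1_norm (l $ i - l $ j) \<le> (\<Sum>(a, b)\<in>E. l1_norm (l $ a - l $ b))"
  proof (rule connected_edge_sum_bound[OF E])
    fix a b c
    show "0 \<le> l1_norm (l $ a - l $ b)" by (simp add: l1_norm_def sum_nonneg)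
    show "l1_norm (l $ a - l $ b) = l1_norm (l $ b - l $ a)" by (simp add: l1_norm_def abs_minus_commute)
    show "l1_norm (l $ a - l $ a) = 0" by (simp add: l1_norm_def)
    show "l1_norm (l $ a - l $ c) \<le> l1_norm (l $ a - l $ b) + l1_norm (l $ b - l $ c)"
      unfolding l1_norm_def sum.distrib[symmetric] by (intro sum_mono) simp
  qed
  also have "E = (SIGMA i:UNIV. neighbors E i)" by (auto simp: neighbors_def)
  also have "(\<Sum>(a, b)\<in>(SIGMA i:UNIV. neighbors E i). l1_norm (l $ a - l $ b)) = 2 * disagreement E l"
    by (subst sum.Sigma[symmetric]) (auto simp: disagreement_def)
  finally show ?thesis by simp
qed

text \<open>
  The node \<open>j\<close> is an arbitrary reference. Each of the \<open>N\<close> deviations \<open>l\<^sub>i - l\<^sub>j\<close> has norm at most the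
  disagreement, so the stacked deviation has norm at most \<open>sqrt N\<close> times it.
\<close>

lemma weighted_sum_le_consensus:
  fixes l G :: "real ^ 'm::finite ^ 'v::finite"
  assumes E: "sym E" "\<And>i j. (i, j) \<in> E\<^sup>*"
  shows "(\<Sum>i\<in>UNIV. l $ i \<bullet> G $ i)
     \<le> l $ j \<bullet> (\<Sum>i\<in>UNIV. G $ i) + sqrt (real CARD('v)) * norm G * disagreement E l"
proof -
  let ?\<phi> = "disagreement E l"
  define e where "e = (\<chi> i. l $ i - l $ j)"
  have le: "norm (e $ i) \<le> ?\<phi>" for i
    using norm_le_l1_cart[of "e $ i"] l1_norm_le_disagreement[OF E, of l i j]
    by (simp add: e_def l1_norm_def)
  then have "0 \<le> ?\<phi>" using norm_ge_zero order_trans by blast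
  have "norm e = sqrt (\<Sum>i\<in>UNIV. (norm (e $ i))\<^sup>2)" by (simp add: norm_vec_def L2_set_def)
  also have "\<dots> \<le> sqrt (\<Sum>i\<in>(UNIV :: 'v set). ?\<phi>\<^sup>2)"
    by (intro real_sqrt_le_mono sum_mono power_mono le) auto
  also have "\<dots> = sqrt (real CARD('v)) * ?\<phi>" using \<open>0 \<le> ?\<phi>\<close> by (simp add: real_sqrt_mult)
  finally have "norm e * norm G \<le> sqrt (real CARD('v)) * ?\<phi> * norm G" by (rule mult_right_mono) simp
  moreover have "e \<bullet> G \<le> norm e * norm G" by (rule norm_cauchy_schwarz)
  moreover have "(\<Sum>i\<in>UNIV. l $ i \<bullet> G $ i) = l $ j \<bullet> (\<Sum>i\<in>UNIV. G $ i) + e \<bullet> G"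
    by (simp add: e_def inner_vec_def[of "_ :: real ^ 'm ^ 'v"] inner_diff_left sum_subtractf inner_sum_right)
  ultimately show ?thesis by (simp add: algebra_simps)
qed

section \<open>The modified Lagrangian of the network\<close>

lemma locally_lipschitz_on_imp_continuous_on:
  assumes "locally_lipschitz_on S F"
  shows "continuous_on S F"
  unfolding continuous_on_eq_continuous_within
proof
  fix x assume x: "x \<in> S"
  then obtain r C where r: "r > 0" "lipschitz_on C (cball x r \<inter> S) F"
    using assms unfolding locally_lipschitz_on_def by blast
  have "continuous_on (cball x r \<inter> S) F" by (rule lipschitz_on_continuous_on[OF r(2)])
  then have "continuous (at x within cball x r \<inter> S) F"
    using x r(1) by (auto simp: continuous_on_eq_continuous_within)
  moreover have "at x within cball x r \<inter> S = at x within S"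
    using r(1) by (intro at_within_nhd[of x "ball x r"]) auto
  ultimately show "continuous (at x within S) F" by simp
qed

lemma strictly_convex_on_imp_convex_on:
  assumes "strictly_convex_on S F"
  shows "convex_on S F"
  unfolding convex_on_def
proof (intro conjI ballI allI impI)
  show "convex S" using assms by (simp add: strictly_convex_on_def)
  fix x y and u v :: real
  assume xy: "x \<in> S" "y \<in> S" and uv: "0 \<le> u" "0 \<le> v" "u + v = 1"
  have u: "u = 1 - v" using uv by simp
  show "F (u *\<^sub>R x + v *\<^sub>R y) \<le> u * F x + v * F y"
  proof (cases "x = y \<or> v = 0 \<or> u = 0")
    case True
    then show ?thesis using uv(3)
      by (auto simp: scaleR_left_distrib[symmetric] distrib_right[symmetric])
  next
    case False
    then show ?thesis using assms xy uv unfolding strictly_convex_on_def u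
      by (intro less_imp_le) auto
  qed
qed

lemma convex_on_linear_preimage:
  assumes "convex_on T h" "linear A" "convex S" "\<And>x. x \<in> S \<Longrightarrow> A x \<in> T"
  shows "convex_on S (\<lambda>x. h (A x))"
  using assms unfolding convex_on_def by (simp add: linear_add linear_scale)

lemma convex_on_sum_functions:
  assumes "convex C" "\<And>i. convex_on C (h i)"
  shows "convex_on C (\<lambda>x. \<Sum>i\<in>S. h i x)"
  by (induction S rule: infinite_finite_induct) (auto simp: assms convex_on_const)

lemma linear_block: "linear (block blk i)"
  by (rule linearI) (auto simp: block_def vec_eq_iff)

lemma sum_block: "(\<Sum>i\<in>UNIV. block blk i x) = x"
  by (simp add: block_def vec_eq_iff)

lemma continuous_on_block: "continuous_on S (block blk i)"
  by (rule linear_continuous_on) (simp add: linear_block linear_conv_bounded_linear[symmetric])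

lemma block_in_block_space: "block blk i x \<in> block_space blk i"
  by (simp add: block_def block_space_def)

lemma block_prodD: "x \<in> block_prod blk S \<Longrightarrow> block blk i x \<in> S i"
  by (simp add: block_prod_def)

lemma block_prod_eq_Inter: "block_prod blk S = (\<Inter>i. block blk i -` S i)"
  by (auto simp: block_prod_def)

lemma open_block_prod:
  assumes "\<And>i. openin (top_of_set (block_space blk i)) (U i)"
  shows "open (block_prod blk U)"
proof -
  have "open (block blk i -` U i)" for i
  proof -
    obtain T where T: "open T" "U i = block_space blk i \<inter> T" using assms[of i] by (auto simp: openin_open)
    have "block blk i -` U i = block blk i -` T" using block_in_block_space by (auto simp: T(2))
    then show ?thesis using open_vimage[OF T(1) continuous_on_block] by simp
  qed
  then show ?thesis unfolding block_prod_eq_Inter by (intro open_INT) auto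
qed

lemma compact_block_prod:
  assumes "\<And>i. compact (S i)"
  shows "compact (block_prod blk S)"
proof -
  have "closed (block_prod blk S)" unfolding block_prod_eq_Inter
    by (intro closed_INT ballI closed_vimage compact_imp_closed assms continuous_on_block)
  moreover have "bounded (block_prod blk S)"
  proof -
    have "\<exists>B. \<forall>i. \<forall>y\<in>S i. norm y \<le> B i"
      using compact_imp_bounded[OF assms] unfolding bounded_iff by (intro choice) blast
    then obtain B where B: "\<And>i y. y \<in> S i \<Longrightarrow> norm y \<le> B i" by blast
    have "norm x \<le> (\<Sum>i\<in>UNIV. B i)" if "x \<in> block_prod blk S" for x
    proof -
      have "norm x = norm (\<Sum>i\<in>UNIV. block blk i x)" by (simp add: sum_block)
      also have "\<dots> \<le> (\<Sum>i\<in>UNIV. norm (block blk i x))" by (rule norm_sum)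
      also have "\<dots> \<le> (\<Sum>i\<in>UNIV. B i)" by (intro sum_mono B block_prodD that)
      finally show ?thesis .
    qed
    then show ?thesis unfolding bounded_iff by blast
  qed
  ultimately show ?thesis by (simp add: compact_eq_bounded_closed)
qed

lemma convex_block_prod:
  assumes "\<And>i. convex (S i)"
  shows "convex (block_prod blk S)"
  unfolding block_prod_eq_Inter by (intro convex_INT convex_linear_vimage linear_block assms)

lemma closed_nonneg_orthant: "closed nonneg_orthant"
  unfolding nonneg_orthant_def
  by (intro closed_Collect_all closed_Collect_le continuous_intros)

lemma convex_nonneg_orthant: "convex nonneg_orthant"
  by (auto simp: convex_def nonneg_orthant_def)

lemma continuous_on_disagreement: "continuous_on S (\<lambda>z. disagreement E (snd z))"
  unfolding disagreement_def l1_norm_def by (intro continuous_intros)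

lemma disagreement_const: "disagreement E (\<chi> i. c) = 0"
  by (simp add: disagreement_def l1_norm_def)

locale constrained_network =
  fixes blk :: "'d::finite \<Rightarrow> 'v::finite"
    and \<Omega> U :: "'v \<Rightarrow> (real ^ 'd) set"
    and f :: "'v \<Rightarrow> real ^ 'd \<Rightarrow> real"
    and g :: "'v \<Rightarrow> real ^ 'd \<Rightarrow> real ^ 'm::finite"
    and E :: "('v \<times> 'v) set"
    and K :: real
  assumes U_open: "\<And>i. openin (top_of_set (block_space blk i)) (U i)"
    and \<Omega>_sub: "\<And>i. \<Omega> i \<subseteq> U i"
    and \<Omega>_compact: "\<And>i. compact (\<Omega> i)"
    and \<Omega>_convex: "\<And>i. convex (\<Omega> i)"
    and f_strict: "\<And>i. strictly_convex_on (U i) (f i)"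
    and g_convex: "\<And>i k. convex_on (U i) (\<lambda>y. g i y $ k)"
    and f_lip: "\<And>i. locally_lipschitz_on (U i) (f i)"
    and g_lip: "\<And>i. locally_lipschitz_on (U i) (g i)"
    and slater: "\<exists>xbar \<in> block_prod blk \<Omega>. \<forall>k. (\<Sum>i\<in>UNIV. g i (block blk i xbar)) $ k < 0"
    and undirected: "sym E"
    and connected: "\<And>i j. (i, j) \<in> E\<^sup>*"
    and K_large: "K > sqrt (real CARD('v)) * max_constraint_norm blk g (block_prod blk \<Omega>)"
begin

abbreviation "X \<equiv> block_prod blk \<Omega>"
abbreviation "D \<equiv> block_prod blk U"
abbreviation "L \<equiv> mod_lagrangian blk f g E K"

definition "total_cost x = (\<Sum>i\<in>UNIV. f i (block blk i x))"
definition "total_constraint x = (\<Sum>i\<in>UNIV. g i (block blk i x))"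

lemma X_subset_D: "X \<subseteq> D"
  using \<Omega>_sub by (auto simp: block_prod_def)

lemma compact_X: "compact X" by (rule compact_block_prod[OF \<Omega>_compact])

lemma convex_X: "convex X" by (rule convex_block_prod[OF \<Omega>_convex])

lemma continuous_on_f_block: "continuous_on D (\<lambda>x. f i (block blk i x))"
  by (rule continuous_on_compose2[OF locally_lipschitz_on_imp_continuous_on[OF f_lip] continuous_on_block])
     (auto dest: block_prodD)

lemma continuous_on_g_block: "continuous_on D (\<lambda>x. g i (block blk i x))"
  by (rule continuous_on_compose2[OF locally_lipschitz_on_imp_continuous_on[OF g_lip] continuous_on_block])
     (auto dest: block_prodD)

lemma continuous_on_L: "continuous_on (D \<times> UNIV) (\<lambda>(x, l). L x l)"
proof -
  have "continuous_on (D \<times> UNIV) (\<lambda>z. f i (block blk i (fst z)))" for i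
    by (rule continuous_on_compose2[OF continuous_on_f_block]) (auto intro!: continuous_intros)
  moreover have "continuous_on (D \<times> UNIV) (\<lambda>z. g i (block blk i (fst z)))" for i
    by (rule continuous_on_compose2[OF continuous_on_g_block]) (auto intro!: continuous_intros)
  ultimately have "continuous_on (D \<times> UNIV) (\<lambda>z. L (fst z) (snd z))"
    unfolding mod_lagrangian_def by (intro continuous_intros continuous_on_disagreement)
  then show ?thesis by (simp add: case_prod_unfold)
qed

lemma norm_constraints_le:
  assumes "x \<in> X"
  shows "norm (\<chi> i. g i (block blk i x)) \<le> max_constraint_norm blk g X"
proof -
  let ?h = "\<lambda>x. norm ((\<chi> i. g i (block blk i x)) :: real ^ 'm ^ 'v)"
  have "continuous_on X ?h"
    by (intro continuous_on_norm continuous_on_vec_lambda continuous_on_subset[OF continuous_on_g_block X_subset_D])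
  then have "bdd_above (?h ` X)"
    by (intro bounded_imp_bdd_above compact_imp_bounded compact_continuous_image compact_X)
  from cSUP_upper[OF assms this] show ?thesis unfolding max_constraint_norm_def .
qed

text \<open>
  Two distinct stacked vectors differ in some block, and there \<open>f i\<close> is strictly convex; in the other
  terms nonnegative multipliers preserve the convexity of the constraints.
\<close>

lemma L_midpoint_less:
  assumes "x \<in> X" "y \<in> X" "x \<noteq> y" "l \<in> nonneg_orthant"
  shows "L ((1/2) *\<^sub>R x + (1/2) *\<^sub>R y) l < (L x l + L y l) / 2"
proof -
  let ?z = "(1/2) *\<^sub>R x + (1/2) *\<^sub>R y"
  define h where "h i w = f i w + l $ i \<bullet> g i w" for i w
  have bz: "block blk i ?z = (1/2) *\<^sub>R block blk i x + (1/2) *\<^sub>R block blk i y" for i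
    by (simp add: linear_add[OF linear_block] linear_scale[OF linear_block])
  have in_U: "block blk i x \<in> U i" "block blk i y \<in> U i" for i
    using assms(1,2) X_subset_D block_prodD by blast+
  have "l $ i \<bullet> g i (block blk i ?z) \<le> (l $ i \<bullet> g i (block blk i x) + l $ i \<bullet> g i (block blk i y)) / 2" for i
  proof -
    have "l $ i $ k * g i (block blk i ?z) $ k
        \<le> (l $ i $ k * g i (block blk i x) $ k + l $ i $ k * g i (block blk i y) $ k) / 2" for k
    proof -
      have "g i (block blk i ?z) $ k \<le> (1/2) * g i (block blk i x) $ k + (1/2) * g i (block blk i y) $ k"
        using g_convex[of i k, unfolded convex_on_def, THEN conjunct2, rule_format, OF in_U[of i], of "1/2" "1/2"]
        by (simp add: bz)
      from mult_left_mono[OF this, of "l $ i $ k"] show ?thesis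
        using assms(4) by (simp add: nonneg_orthant_def algebra_simps add_divide_distrib)
    qed
    then show ?thesis
      unfolding inner_vec_def inner_real_def sum.distrib[symmetric] sum_divide_distrib by (intro sum_mono)
  qed
  note g_le = this
  have f_less: "f i (block blk i ?z) < (f i (block blk i x) + f i (block blk i y)) / 2"
    if "block blk i x \<noteq> block blk i y" for i
    using f_strict[of i, unfolded strictly_convex_on_def, THEN conjunct2, rule_format, OF in_U that, of "1/2"]
    by (simp add: bz add_divide_distrib)
  have f_le: "f i (block blk i ?z) \<le> (f i (block blk i x) + f i (block blk i y)) / 2" for i
  proof (cases "block blk i x = block blk i y")
    case True
    have "(1/2) *\<^sub>R w + (1/2) *\<^sub>R w = w" for w :: "real ^ 'd"
      by (simp add: scaleR_left_distrib[symmetric])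
    then show ?thesis using True by (simp add: bz)
  qed (use f_less in force)
  obtain j where j: "block blk j x \<noteq> block blk j y"
  proof (rule ccontr)
    assume "\<not> thesis"
    then have "(\<Sum>i\<in>UNIV. block blk i x) = (\<Sum>i\<in>UNIV. block blk i y)"
      using that by (intro sum.cong refl) blast
    then show False using assms(3) by (simp add: sum_block)
  qed
  have "(\<Sum>i\<in>UNIV. h i (block blk i ?z)) < (\<Sum>i\<in>UNIV. (h i (block blk i x) + h i (block blk i y)) / 2)"
  proof (rule sum_strict_mono_ex1)
    show "\<forall>i\<in>UNIV. h i (block blk i ?z) \<le> (h i (block blk i x) + h i (block blk i y)) / 2"
    proof
      fix i show "h i (block blk i ?z) \<le> (h i (block blk i x) + h i (block blk i y)) / 2"
        using add_mono[OF f_le[of i] g_le[of i]] by (simp add: h_def add_divide_distrib)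
    qed
    have "h j (block blk j ?z) < (h j (block blk j x) + h j (block blk j y)) / 2"
      using add_less_le_mono[OF f_less[OF j] g_le[of j]] by (simp add: h_def add_divide_distrib)
    then show "\<exists>i\<in>UNIV. h i (block blk i ?z) < (h i (block blk i x) + h i (block blk i y)) / 2" by blast
  qed simp
  also have "\<dots> = ((\<Sum>i\<in>UNIV. h i (block blk i x)) + (\<Sum>i\<in>UNIV. h i (block blk i y))) / 2"
    by (simp add: sum.distrib sum_divide_distrib[symmetric])
  finally show ?thesis by (simp add: mod_lagrangian_def h_def[symmetric])
qed

lemma saddle_primal_unique:
  assumes "(xs, ls) \<in> saddle_points X nonneg_orthant L" "x \<in> X" "L x ls \<le> L xs ls"
  shows "x = xs"
proof (rule ccontr)
  assume "x \<noteq> xs"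
  have s: "xs \<in> X" "ls \<in> nonneg_orthant" "\<And>y. y \<in> X \<Longrightarrow> L xs ls \<le> L y ls"
    using assms(1) by (auto simp: saddle_points_def)
  have "(1/2) *\<^sub>R x + (1/2) *\<^sub>R xs \<in> X" using convexD[OF convex_X assms(2) s(1)] by simp
  from s(3)[OF this] L_midpoint_less[OF assms(2) s(1) \<open>x \<noteq> xs\<close> s(2)] assms(3) show False by simp
qed

text \<open>
  The primal component is a minimizer \<open>xs\<close> of the total cost subject to the aggregated constraint, the
  dual one a Slater multiplier \<open>\<mu>\<close> copied to all nodes. For an arbitrary \<open>m \<ge> 0\<close> the value at a
  reference node contributes at most 0 since \<open>xs\<close> is feasible, and the deviation from it is absorbed
  by the penalty.
\<close>

lemma saddle_point_exists: "saddle_points X nonneg_orthant L \<noteq> {}"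
proof -
  obtain xbar where xbar: "xbar \<in> X" "\<And>k. total_constraint xbar $ k < 0" using slater by (auto simp: total_constraint_def)
  have contF: "continuous_on X total_cost"
    unfolding total_cost_def[abs_def] by (intro continuous_intros continuous_on_subset[OF continuous_on_f_block X_subset_D])
  have contG: "continuous_on X total_constraint"
    unfolding total_constraint_def[abs_def] by (intro continuous_intros continuous_on_subset[OF continuous_on_g_block X_subset_D])
  define A where "A = X \<inter> total_constraint -` {y. \<forall>k. y $ k \<le> 0}"
  have "closed {y :: real ^ 'm. \<forall>k. y $ k \<le> 0}"
    by (intro closed_Collect_all closed_Collect_le continuous_intros)
  then have "closed A" unfolding A_def
    by (rule continuous_closed_preimage[OF contG compact_imp_closed[OF compact_X]])
  then have "compact (X \<inter> A)" by (rule compact_Int_closed[OF compact_X])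
  then have "compact A" by (simp add: A_def)
  moreover have "xbar \<in> A" using xbar by (simp add: A_def less_imp_le)
  then have "A \<noteq> {}" by blast
  moreover have "continuous_on A total_cost" by (rule continuous_on_subset[OF contF]) (simp add: A_def)
  ultimately obtain xs where xs: "xs \<in> A" "\<And>y. y \<in> A \<Longrightarrow> total_cost xs \<le> total_cost y"
    using continuous_attains_inf[of A total_cost] by blast
  have xsX: "xs \<in> X" "\<And>k. total_constraint xs $ k \<le> 0" using xs(1) by (auto simp: A_def)
  have block_U: "block blk i x \<in> U i" if "x \<in> X" for i x using that X_subset_D block_prodD by blast
  have "convex_on X (\<lambda>x. f i (block blk i x))" for i
    by (rule convex_on_linear_preimage[OF strictly_convex_on_imp_convex_on[OF f_strict] linear_block convex_X block_U])
  then have convex_cost: "convex_on X total_cost"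
    unfolding total_cost_def[abs_def] by (rule convex_on_sum_functions[OF convex_X])
  have "convex_on X (\<lambda>x. g i (block blk i x) $ k)" for i k
    by (rule convex_on_linear_preimage[OF g_convex linear_block convex_X block_U])
  then have convex_constraint: "convex_on X (\<lambda>x. total_constraint x $ k)" for k
    unfolding total_constraint_def[abs_def] sum_component by (rule convex_on_sum_functions[OF convex_X])
  obtain \<mu> where \<mu>: "\<And>k. 0 \<le> \<mu> $ k" "\<And>x. x \<in> X \<Longrightarrow> total_cost xs \<le> total_cost x + \<mu> \<bullet> total_constraint x"
    using slater_multiplier[OF convex_cost convex_constraint xbar, of "total_cost xs"] xs(2) by (auto simp: A_def)
  have neg: "y \<bullet> total_constraint xs \<le> 0" if "\<And>k. 0 \<le> y $ k" for y
    unfolding inner_vec_def using that xsX(2) by (auto intro!: sum_nonpos mult_nonneg_nonpos)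
  have compl: "\<mu> \<bullet> total_constraint xs = 0" using \<mu>(2)[OF xsX(1)] neg[OF \<mu>(1)] by simp
  define ls :: "real ^ 'm ^ 'v" where "ls = (\<chi> i. \<mu>)"
  have L_ls: "L x ls = total_cost x + \<mu> \<bullet> total_constraint x" for x
    unfolding ls_def mod_lagrangian_def disagreement_const
    by (simp add: total_cost_def total_constraint_def sum.distrib inner_sum_right)
  have "L xs m \<le> L xs ls" if m: "m \<in> nonneg_orthant" for m
  proof -
    obtain j :: 'v where True by simp
    let ?\<phi> = "disagreement E m" and ?G = "(\<chi> i. g i (block blk i xs)) :: real ^ 'm ^ 'v"
    have "0 \<le> ?\<phi>" by (simp add: disagreement_def l1_norm_def sum_nonneg)
    have "(\<Sum>i\<in>UNIV. m $ i \<bullet> ?G $ i)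
       \<le> m $ j \<bullet> (\<Sum>i\<in>UNIV. ?G $ i) + sqrt (real CARD('v)) * norm ?G * ?\<phi>"
      by (rule weighted_sum_le_consensus[OF undirected connected])
    also have "m $ j \<bullet> (\<Sum>i\<in>UNIV. ?G $ i) \<le> 0"
      using neg[of "m $ j"] m by (simp add: total_constraint_def nonneg_orthant_def)
    also have "sqrt (real CARD('v)) * norm ?G * ?\<phi> \<le> K * ?\<phi>"
    proof (rule mult_right_mono[OF _ \<open>0 \<le> ?\<phi>\<close>])
      have "sqrt (real CARD('v)) * norm ?G \<le> sqrt (real CARD('v)) * max_constraint_norm blk g X"
        by (intro mult_left_mono norm_constraints_le xsX) simp
      then show "sqrt (real CARD('v)) * norm ?G \<le> K"
        by (rule order_trans[OF _ less_imp_le[OF K_large]])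
    qed
    finally have "(\<Sum>i\<in>UNIV. m $ i \<bullet> g i (block blk i xs)) \<le> K * ?\<phi>" by simp
    then show ?thesis unfolding L_ls compl by (simp add: mod_lagrangian_def total_cost_def sum.distrib)
  qed
  moreover have "L xs ls \<le> L y ls" if "y \<in> X" for y
    unfolding L_ls compl using \<mu>(2)[OF that] by simp
  ultimately have "(xs, ls) \<in> saddle_points X nonneg_orthant L"
    using xsX(1) \<mu>(1) by (auto simp: saddle_points_def nonneg_orthant_def ls_def)
  then show ?thesis by blast
qed

lemma saddle_flow: "saddle_flow D X nonneg_orthant L"
  by unfold_locales
    (fact compact_X convex_X open_block_prod[OF U_open] X_subset_D closed_nonneg_orthant
      convex_nonneg_orthant continuous_on_L saddle_point_exists
    | erule (2) saddle_primal_unique)+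

end

section \<open>Stability and convergence\<close>

theorem mainTheorem4:
  fixes blk :: "'d::finite \<Rightarrow> 'v::finite"
    and \<Omega> U :: "'v \<Rightarrow> (real ^ 'd) set"
    and f :: "'v \<Rightarrow> real ^ 'd \<Rightarrow> real"
    and g :: "'v \<Rightarrow> real ^ 'd \<Rightarrow> real ^ 'm::finite"
    and E :: "('v \<times> 'v) set"
    and K :: real
  defines "\<Omega>\<Omega> \<equiv> block_prod blk \<Omega>"
    and "UU \<equiv> block_prod blk U"
    and "L \<equiv> mod_lagrangian blk f g E K"
  assumes U_open: "\<And>i. openin (top_of_set (block_space blk i)) (U i)"
    and U_convex: "\<And>i. convex (U i)"
    and \<Omega>_sub: "\<And>i. \<Omega> i \<subseteq> U i"
    and \<Omega>_compact: "\<And>i. compact (\<Omega> i)"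
    and \<Omega>_convex: "\<And>i. convex (\<Omega> i)"
    and f_strict: "\<And>i. strictly_convex_on (U i) (f i)"
    and g_convex: "\<And>i k. convex_on (U i) (\<lambda>y. g i y $ k)"
    and f_lip: "\<And>i. locally_lipschitz_on (U i) (f i)"
    and g_lip: "\<And>i. locally_lipschitz_on (U i) (g i)"
    and slater: "\<exists>xbar \<in> rel_interior \<Omega>\<Omega>. \<forall>k. (\<Sum>i\<in>UNIV. g i (block blk i xbar)) $ k < 0"
    and undirected: "sym E"
    and connected: "\<And>i j. (i, j) \<in> E\<^sup>*"
    and K_pos: "K > 0"
    and K_large: "K > sqrt (real CARD('v)) * max_constraint_norm blk g \<Omega>\<Omega>"
  shows "(\<forall>p. is_equilibrium UU \<Omega>\<Omega> nonneg_orthant L p \<longrightarrow>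
              lyapunov_stable UU \<Omega>\<Omega> nonneg_orthant L p) \<and>
         (\<forall>x l. is_solution UU \<Omega>\<Omega> nonneg_orthant L x l \<longrightarrow>
              ((\<lambda>t. infdist (x t, l t) (saddle_points \<Omega>\<Omega> nonneg_orthant L)) \<longlongrightarrow> 0) at_top) \<and>
         (\<forall>x l. is_solution UU \<Omega>\<Omega> nonneg_orthant L x l \<longrightarrow>
              (\<exists>p \<in> saddle_points \<Omega>\<Omega> nonneg_orthant L. ((\<lambda>t. (x t, l t)) \<longlongrightarrow> p) at_top))"
proof -
  have "\<exists>xbar \<in> block_prod blk \<Omega>. \<forall>k. (\<Sum>i\<in>UNIV. g i (block blk i xbar)) $ k < 0"
    using slater rel_interior_subset[of \<Omega>\<Omega>] unfolding \<Omega>\<Omega>_def by blast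
  moreover note K_large[unfolded \<Omega>\<Omega>_def]
  ultimately have "constrained_network blk \<Omega> U f g E K"
    using U_open \<Omega>_sub \<Omega>_compact \<Omega>_convex f_strict g_convex f_lip g_lip undirected connected
    by (intro constrained_network.intro)
  then interpret saddle_flow UU \<Omega>\<Omega> nonneg_orthant L
    unfolding \<Omega>\<Omega>_def UU_def L_def by (rule constrained_network.saddle_flow)
  have limit: "\<exists>p \<in> saddle_points \<Omega>\<Omega> nonneg_orthant L. ((\<lambda>t. (x t, l t)) \<longlongrightarrow> p) at_top"
    if "is_solution UU \<Omega>\<Omega> nonneg_orthant L x l" for x l
  proof -
    interpret saddle_flow_solution UU \<Omega>\<Omega> nonneg_orthant L x l by unfold_locales (rule that)
    show ?thesis by (rule converges_to_saddle_point)
  qed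
  have "((\<lambda>t. infdist (x t, l t) (saddle_points \<Omega>\<Omega> nonneg_orthant L)) \<longlongrightarrow> 0) at_top"
    if sol: "is_solution UU \<Omega>\<Omega> nonneg_orthant L x l" for x l
  proof -
    obtain p where p: "p \<in> saddle_points \<Omega>\<Omega> nonneg_orthant L" "((\<lambda>t. (x t, l t)) \<longlongrightarrow> p) at_top"
      using limit[OF sol] by blast
    from tendsto_infdist[OF p(2), of "saddle_points \<Omega>\<Omega> nonneg_orthant L"] p(1) show ?thesis by simp
  qed
  then show ?thesis using limit equilibrium_is_saddle_point saddle_point_lyapunov_stable by blast
qed

end
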